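(* Let $n\ge1$, $\beta\in(0,2]$, and $p>1$. Let $\mathcal{K}:(0,\infty)\to(0,\infty)$ be continuous with $\mathcal{K}(|\cdot|)\in L^1_{\mathrm{loc}}(\mathbb{R}^n)$, and suppose there exists $R_0>1$ such that $\inf_{r\in(0,R)}\mathcal{K}(r)=\mathcal{K}(R)$ for all $R>R_0$. Consider the Cauchy problem $$u_t+(-\Delta)^{\beta/2}u=\mathcal{K}*|u|^p,\quad x\in\mathbb{R}^n,\ t>0,\qquad u(x,0)=u_0(x),\quad x\in\mathbb{R}^n. \quad (Q)$$ (i) If $u_0\in L^1(\mathbb{R}^n)$, $$\int_{\mathbb{R}^n}u_0(x)\,dx>0\qquad\text{and}\qquad\limsup_{R\to\infty}\left(\mathcal{K}(R)\,R^{\frac{n+\beta}{p}}\right)>0,$$ then (Q) has no global weak nonnegative solutions. (ii) If $u_0\in L^1_{\mathrm{loc}}(\mathbb{R}^n)$, $$\liminf_{R\to\infty}R^{-n}(\mathcal{K}(R))^{-1}\int_{B_R}u_0(x)\,dx\ge0\qquad\text{and}\qquad\limsup_{R\to\infty}\left(\mathcal{K}(R)\,R^{\frac{n+\beta}{p}}\right)>0,$$ then (Q) has no global weak nontrivial nonnegative solutions. (iii) If $u_0\in L^1_{\mathrm{loc}}(\mathbb{R}^n)$ and, for some constant $\varepsilon>0$ and some exponent $\gamma>0$ (any positive value of $\gamma$ being allowed), $$u_0(x)\ge\varepsilon(1+|x|^2)^{-\gamma/2}\qquad\text{and}\qquad\liminf_{R\to\infty}\left(\mathcal{K}(R)^{-1}R^{\gamma(p-1)-n-\beta}\right)=0,$$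 then (Q) has no global weak nonnegative solutions.
   Context: $B_R$ is the closed ball of radius $R$ centered at the origin of $\mathbb{R}^n$. The convolution is in the space variable: $(\mathcal{K}*|u|^p)(t,x)=\int_{\mathbb{R}^n}\mathcal{K}(|x-y|)|u(t,y)|^p\,dy$. The operator $(-\Delta)^{\beta/2}$ acts in $x$; for $\beta=2$ it is $-\Delta$, and for $\beta\in(0,2)$, with $\sigma=\beta/2$, $$(-\Delta)^{\sigma}v(x)=C_{n,\sigma}\,\mathrm{p.v.}\int_{\mathbb{R}^n}\frac{v(x)-v(y)}{|x-y|^{n+2\sigma}}\,dy,\qquad C_{n,\sigma}=\frac{4^{\sigma}\Gamma(\frac n2+\sigma)}{\pi^{n/2}|\Gamma(-\sigma)|}.$$ Weak solution of (Q): let $u_0\in L^1_{\mathrm{loc}}(\mathbb{R}^n)$ and $0<T\le\infty$. A function $u\in L^1_{\mathrm{loc}}((0,T)\times\mathbb{R}^n)$ is a weak solution of (Q) on $[0,T)\times\mathbb{R}^n$ if $\mathcal{K}*|u|^p\in L^1_{\mathrm{loc}}((0,T)\times\mathbb{R}^n)$ and, for every $0\le\tau<T$ and every compactly supported test function $\psi\in C^{1,2}_{t,x}([0,T)\times\mathbb{R}^n)$ with $\psi(\tau,\cdot)=0$, $$\int_0^\tau\!\!\int_{\mathbb{R}^n}(\mathcal{K}*|u|^p)\psi\,dx\,dt+\int_{\mathbb{R}^n}u_0(x)\psi(0,x)\,dx=\int_0^\tau\!\!\int_{\mathbb{R}^n}u\,(-\Delta)^{\beta/2}\psi\,dx\,dt-\int_0^\tau\!\!\int_{\mathbb{R}^n}u\,\psi_t\,dx\,dt,$$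 where all integrals are (absolutely convergent) Lebesgue integrals. If $T=\infty$, $u$ is called a global (in time) weak solution. "Nonnegative" means $u\ge0$ a.e., and "nontrivial" means $u$ is not a.e. equal to $0$. *)

theory Defs
  imports "HOL-Analysis.Analysis"
begin

definition locally_integrable_on :: "('a::euclidean_space \<Rightarrow> real) \<Rightarrow> 'a set \<Rightarrow> bool"
  (infixr \<open>locally'_integrable'_on\<close> 46) where
  "f locally_integrable_on \<Omega> \<longleftrightarrow>
     (\<forall>C. compact C \<and> C \<subseteq> \<Omega> \<longrightarrow> f absolutely_integrable_on C)"

definition partial_deriv :: "'n::finite \<Rightarrow> (real^'n \<Rightarrow> real) \<Rightarrow> real^'n \<Rightarrow> real" where
  "partial_deriv i v x = deriv (\<lambda>h. v (x + h *\<^sub>R axis i 1)) 0"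

definition laplacian :: "(real^'n \<Rightarrow> real) \<Rightarrow> real^'n \<Rightarrow> real" where
  "laplacian v x = (\<Sum>i\<in>UNIV. partial_deriv i (partial_deriv i v) x)"

definition frac_const :: "nat \<Rightarrow> real \<Rightarrow> real" where
  "frac_const n \<sigma> =
     4 powr \<sigma> * Gamma (real n / 2 + \<sigma>) / (pi powr (real n / 2) * \<bar>Gamma (- \<sigma>)\<bar>)"

text \<open>The principal value is the limit, as the radius decreases to 0, of the integrals over the
  complement of a ball centred at the singularity.\<close>

definition frac_laplacian :: "real \<Rightarrow> (real^'n \<Rightarrow> real) \<Rightarrow> real^'n \<Rightarrow> real" where
  "frac_laplacian \<sigma> v x =
     frac_const CARD('n) \<sigma> *
     Lim (at_right 0) (\<lambda>\<delta>. LINT y : - ball x \<delta> | lebesgue.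
       (v x - v y) / norm (x - y) powr (real CARD('n) + 2 * \<sigma>))"

definition diffusion :: "real \<Rightarrow> (real^'n \<Rightarrow> real) \<Rightarrow> real^'n \<Rightarrow> real" where
  "diffusion \<beta> v x = (if \<beta> = 2 then - laplacian v x else frac_laplacian (\<beta> / 2) v x)"

text \<open>The value \<open>K 0\<close> is irrelevant: it enters only at the null set \<open>y = x\<close>. The Bochner integral
  is 0 where the integral diverges, so finiteness almost everywhere is a separate condition in
  the definition of weak solutions below.\<close>

definition conv_power ::
  "(real \<Rightarrow> real) \<Rightarrow> real \<Rightarrow> (real \<Rightarrow> real^'n \<Rightarrow> real) \<Rightarrow> real \<Rightarrow> real^'n \<Rightarrow> real" where
  "conv_power K p u t x = (LINT y | lebesgue. K (norm (x - y)) * \<bar>u t y\<bar> powr p)"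

definition open_cyl :: "ereal \<Rightarrow> (real \<times> (real^'n)) set" where
  "open_cyl T = {t. 0 < t \<and> ereal t < T} \<times> UNIV"

definition halfopen_cyl :: "ereal \<Rightarrow> (real \<times> (real^'n)) set" where
  "halfopen_cyl T = {t. 0 \<le> t \<and> ereal t < T} \<times> UNIV"

text \<open>Here \<open>G\<close> and \<open>H\<close> are the first and second space derivatives; all derivatives are continuous
  up to \<open>t = 0\<close>, where the time derivative is one-sided. Values of \<open>\<psi>\<close> at times outside \<open>[0,T)\<close>
  play no role, and the compact support may meet \<open>t = 0\<close>.\<close>

definition test_function :: "ereal \<Rightarrow> (real \<Rightarrow> real^'n \<Rightarrow> real) \<Rightarrow> bool" where
  "test_function T \<psi> \<longleftrightarrow>
     continuous_on (halfopen_cyl T) (\<lambda>(t, x). \<psi> t x) \<and>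
     (\<exists>\<psi>t. continuous_on (halfopen_cyl T) (\<lambda>(t, x). \<psi>t t x) \<and>
        (\<forall>(t, x) \<in> halfopen_cyl T.
           ((\<lambda>s. \<psi> s x) has_real_derivative \<psi>t t x) (at t within {s. 0 \<le> s \<and> ereal s < T}))) \<and>
     (\<exists>G H. \<forall>i. continuous_on (halfopen_cyl T) (\<lambda>(t, x). G i t x) \<and>
        (\<forall>(t, x) \<in> halfopen_cyl T.
           ((\<lambda>h. \<psi> t (x + h *\<^sub>R axis i 1)) has_real_derivative G i t x) (at 0)) \<and>
        (\<forall>j. continuous_on (halfopen_cyl T) (\<lambda>(t, x). H i j t x) \<and>
           (\<forall>(t, x) \<in> halfopen_cyl T.
              ((\<lambda>h. G i t (x + h *\<^sub>R axis j 1)) has_real_derivative H i j t x) (at 0)))) \<and>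
     (\<exists>C. compact C \<and> C \<subseteq> halfopen_cyl T \<and> (\<forall>(t, x) \<in> halfopen_cyl T - C. \<psi> t x = 0))"

text \<open>Since they are required to converge absolutely, the iterated integrals in \<open>t\<close> and \<open>x\<close> are
  written as integrals over \<open>open_cyl \<tau>\<close> for the Lebesgue measure of the product space.\<close>

definition weak_solution ::
  "(real \<Rightarrow> real) \<Rightarrow> real \<Rightarrow> real \<Rightarrow> (real^'n \<Rightarrow> real) \<Rightarrow> ereal \<Rightarrow> (real \<Rightarrow> real^'n \<Rightarrow> real) \<Rightarrow> bool"
  where
  "weak_solution K \<beta> p u0 T u \<longleftrightarrow>
     0 < T \<and>
     (\<lambda>(t, x). u t x) locally_integrable_on open_cyl T \<and>
     (AE (t, x) in lebesgue. (t, x) \<in> open_cyl T \<longrightarrow>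
        integrable lebesgue (\<lambda>y. K (norm (x - y)) * \<bar>u t y\<bar> powr p)) \<and>
     (\<lambda>(t, x). conv_power K p u t x) locally_integrable_on open_cyl T \<and>
     (\<forall>\<tau> \<psi>. 0 \<le> \<tau> \<and> ereal \<tau> < T \<and> test_function T \<psi> \<and> (\<forall>x. \<psi> \<tau> x = 0) \<longrightarrow>
        (\<lambda>(t, x). conv_power K p u t x * \<psi> t x) absolutely_integrable_on open_cyl (ereal \<tau>) \<and>
        integrable lebesgue (\<lambda>x. u0 x * \<psi> 0 x) \<and>
        (\<lambda>(t, x). u t x * diffusion \<beta> (\<psi> t) x) absolutely_integrable_on open_cyl (ereal \<tau>) \<and>
        (\<lambda>(t, x). u t x * deriv (\<lambda>s. \<psi> s x) t) absolutely_integrable_on open_cyl (ereal \<tau>) \<and>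
        (LINT (t, x) : open_cyl (ereal \<tau>) | lebesgue. conv_power K p u t x * \<psi> t x) +
        (LINT x | lebesgue. u0 x * \<psi> 0 x) =
        (LINT (t, x) : open_cyl (ereal \<tau>) | lebesgue. u t x * diffusion \<beta> (\<psi> t) x) -
        (LINT (t, x) : open_cyl (ereal \<tau>) | lebesgue. u t x * deriv (\<lambda>s. \<psi> s x) t))"

abbreviation global_weak_solution ::
  "(real \<Rightarrow> real) \<Rightarrow> real \<Rightarrow> real \<Rightarrow> (real^'n \<Rightarrow> real) \<Rightarrow> (real \<Rightarrow> real^'n \<Rightarrow> real) \<Rightarrow> bool" where
  "global_weak_solution K \<beta> p u0 u \<equiv> weak_solution K \<beta> p u0 \<infinity> u"

definition nonneg_ae :: "(real \<Rightarrow> real^'n \<Rightarrow> real) \<Rightarrow> bool" where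
  "nonneg_ae u \<longleftrightarrow> (AE (t, x) in lebesgue. (t, x) \<in> open_cyl \<infinity> \<longrightarrow> 0 \<le> u t x)"

definition nontrivial :: "(real \<Rightarrow> real^'n \<Rightarrow> real) \<Rightarrow> bool" where
  "nontrivial u \<longleftrightarrow> \<not> (AE (t, x) in lebesgue. (t, x) \<in> open_cyl \<infinity> \<longrightarrow> u t x = 0)"

end

theory Submission
  imports Defs
begin

text \<open>Test with \<open>\<psi> = (1 - t / R\<^sup>\<beta>)\<^sub>+\<^sup>l \<phi>(x / R)\<close>, where \<open>\<phi>\<close> is a radial \<open>C\<^sup>2\<close> cutoff. Where \<open>\<phi>(x / R) = 0\<close> the
  fractional Laplacian of the cutoff is nonpositive, so by \<open>u \<ge> 0\<close> its nonlocal tail can be dropped, and elsewhere it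
  is at most \<open>C R\<^sup>-\<^sup>\<beta>\<close>. Since \<open>K(\<bar>x - y\<bar>) \<ge> K(3R)\<close> for \<open>\<bar>x\<bar> \<le> R\<close> and \<open>\<bar>y\<bar> \<le> 2R\<close>, the left-hand side dominates
  \<open>R\<^sup>n K(3R)\<close> times the weighted integral \<open>X\<close> of \<open>u\<^sup>p\<close> over \<open>\<bar>x\<bar> \<le> 2R\<close>, and Young's inequality absorbs the
  right-hand side. This gives (iii) directly. Under the critical growth condition it first shows that \<open>u\<^sup>p\<close> is
  integrable on the half space; splitting the right-hand side into a small inner ball, where the Young remainder is
  small, and its complement, where the integral of \<open>u\<^sup>p\<close> tends to 0, then gives \<open>u = 0\<close>.\<close>

section \<open>The principal value integral of the fractional Laplacian\<close>

text \<open>The nonlocal source lets the cutoff enter to the first power. With a local source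
  \<open>u^p\<close>, its integral against the test function would have to absorb the derivatives
  near the edge of the support, which calls for a high power of the cutoff. Here testing at
  \<bar>x\<bar> \<le> R, where the cutoff is 1, already sees \<open>u^p\<close> on all of
  \<bar>y\<bar> \<le> 2R, even where the cutoff vanishes. Nothing is smeared in time, so the time
  factor does need its power: the time derivative has exponent l - 1, the p-th root of the weight
  has l/p, and l - 1 \<ge> l/p is required. The obstacle is that \<open>K\<close> is not assumed
  doubling, so \<open>K R\<close> may be far larger than \<open>K (3 * R)\<close>. Absorption works
  with \<open>K (3 * R)\<close>, but the initial data are measured against \<open>K R\<close>. The
  source is therefore bounded below twice and half of each bound is kept: one absorbs, the other,
  from points of the ball of radius R/2, supplies the factor \<open>K R\<close> by which the final
  inequality is divided. The limsup condition yields good radii only along an unbounded set, so the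
  estimates hold frequently.\<close>

lemma integral_lborel_affine:
  fixes f :: "'a::euclidean_space \<Rightarrow> real"
  assumes [measurable]: "f \<in> borel_measurable borel" and c: "c \<noteq> 0"
  shows "(LINT x|lborel. f x) = \<bar>c\<bar> ^ DIM('a) * (LINT x|lborel. f (t + c *\<^sub>R x))"
  by (subst lborel_affine[OF c, of t])
     (simp add: integral_density integral_distr)

lemma integrable_lborel_affine:
  fixes f :: "'a::euclidean_space \<Rightarrow> real"
  assumes [measurable]: "f \<in> borel_measurable borel" and c: "c \<noteq> 0"
  shows "integrable lborel f \<longleftrightarrow> integrable lborel (\<lambda>x. f (t + c *\<^sub>R x))"
  by (subst lborel_affine[OF c, of t])
     (simp add: integrable_density integrable_distr_eq c)

lemma ex_dyadic_scale:
  fixes r :: real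
  assumes "1 \<le> r"
  shows "\<exists>k::nat. 2 ^ k \<le> r \<and> r \<le> 2 ^ Suc k"
proof -
  define k where "k = nat \<lfloor>log 2 r\<rfloor>"
  have "0 \<le> log 2 r" using assms by simp
  then have "real k \<le> log 2 r" "log 2 r \<le> real (Suc k)"
    unfolding k_def by linarith+
  then have "2 powr real k \<le> r" "r \<le> 2 powr real (Suc k)"
    using assms by (simp_all add: le_log_iff log_le_iff)
  then show ?thesis by (metis powr_realpow zero_less_numeral)
qed

text \<open>Comparison with balls of dyadic radius replaces polar coordinates. Their volumes cancel
  the factor \<bar>z\<bar>^(-n) and leave geometric series of ratio 2^(-(2 - 2\<sigma>)) near the
  origin and 2^(-2\<sigma>) at infinity, which converge because 0 < \<sigma> < 1.\<close>

lemma integrable_frac_kernel: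
  fixes \<sigma> :: real
  assumes "0 < \<sigma>" "\<sigma> < 1"
  shows "integrable lborel
    (\<lambda>z::'a::euclidean_space. min ((norm z)\<^sup>2) 1 / norm z powr (real DIM('a) + 2 * \<sigma>))"
proof -
  define n where "n = DIM('a)"
  define f where "f = (\<lambda>z::'a. min ((norm z)\<^sup>2) 1 / norm z powr (real n + 2 * \<sigma>))"
  \<comment> \<open>\<open>a k\<close> bounds \<open>f\<close> on 2^-(k+1) \<le> \<bar>z\<bar> \<le>
    2^-k, and \<open>b k\<close> on 2^k \<le> \<bar>z\<bar> \<le> 2^(k+1). \<open>S\<close> spreads
    each bound over the whole ball of the outer radius, whose volume is explicit.\<close>
  define a :: "nat \<Rightarrow> real" where "a k = (2 powr (-(2 - 2 * \<sigma>))) ^ k * (2 ^ Suc k) ^ n" for k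
  define b :: "nat \<Rightarrow> real" where "b k = (2 powr (-2 * \<sigma>)) ^ k * inverse (2 ^ k) ^ n" for k
  have pw: "(2 ^ k) powr x = (2 powr x) ^ k" for k and x :: real
    by (simp add: powr_realpow[symmetric] powr_powr mult.commute)
  define S where "S k z = ennreal (a k) * indicator (cball 0 (inverse (2 ^ k))) z
      + ennreal (b k) * indicator (cball 0 (2 ^ Suc k)) z" for k and z :: 'a
  have [measurable]: "f \<in> borel_measurable borel" unfolding f_def by measurable
  have f0: "0 \<le> f z" for z unfolding f_def by simp
  have a0: "0 \<le> a k" and b0: "0 \<le> b k" for k unfolding a_def b_def by simp_all
  have bd: "ennreal (f z) \<le> (\<Sum>k. S k z)" for z
  proof -
    have *: "\<exists>k. ennreal (f z) \<le> S k z"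
    proof (cases "z = 0")
      case True then show ?thesis by (simp add: f_def)
    next
      case z: False
      define r where "r = norm z"
      have r: "0 < r" using z by (simp add: r_def)
      show ?thesis
      proof (cases "1 \<le> r")
        case True
        then obtain k :: nat where k: "2 ^ k \<le> r" "r \<le> 2 ^ Suc k" using ex_dyadic_scale by blast
        have "f z = r powr (- (real n + 2 * \<sigma>))"
          using True by (simp only: f_def r_def[symmetric] powr_minus_divide) (simp add: min_absorb2)
        also have "\<dots> \<le> (2 ^ k) powr (- (real n + 2 * \<sigma>))"
          using k assms by (intro powr_mono2') auto
        also have "\<dots> = b k"
        proof -
          have "- (real n + 2 * \<sigma>) = -2 * \<sigma> + (- real n)" by simp
          then have "(2 ^ k) powr (- (real n + 2 * \<sigma>)) = (2 ^ k) powr (-2 * \<sigma>) * (2 ^ k) powr (- real n)"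
            by (metis powr_add)
          then show ?thesis unfolding b_def pw[symmetric]
            by (simp add: powr_minus powr_realpow power_inverse)
        qed
        finally have "ennreal (f z) \<le> ennreal (b k)" by (rule ennreal_leI)
        moreover have "ennreal (b k) \<le> S k z" using k by (simp add: S_def r_def)
        ultimately show ?thesis using order_trans by blast
      next
        case False
        then have "1 \<le> inverse r" using r by (simp add: one_le_inverse)
        then obtain k :: nat where k: "2 ^ k \<le> inverse r" "inverse r \<le> 2 ^ Suc k" using ex_dyadic_scale by blast
        have k': "r \<le> inverse (2 ^ k)" "inverse (2 ^ Suc k) \<le> r"
          using le_imp_inverse_le[OF k(1)] le_imp_inverse_le[OF k(2)] r by simp_all
        have "f z = r ^ 2 / r powr (real n + 2 * \<sigma>)"
          using False r by (simp add: f_def r_def[symmetric] power_le_one min_absorb1)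
        also have "\<dots> = r powr (2 - 2 * \<sigma>) * r powr (- real n)"
        proof -
          have "r ^ 2 = r powr 2" using r by simp
          moreover have "2 - (real n + 2 * \<sigma>) = (2 - 2 * \<sigma>) + (- real n)" by simp
          ultimately show ?thesis using r by (metis powr_add powr_diff)
        qed
        also have "\<dots> \<le> inverse (2 ^ k) powr (2 - 2 * \<sigma>) * inverse (2 ^ Suc k) powr (- real n)"
          using k' r assms by (intro mult_mono powr_mono2 powr_mono2') auto
        also have "\<dots> = a k"
        proof -
          have "inverse (2 ^ k) powr (2 - 2 * \<sigma>) = (2 ^ k) powr (- (2 - 2 * \<sigma>))"
            by (subst powr_minus, subst inverse_powr) simp_all
          moreover have "inverse (2 ^ Suc k) powr (- real n) = (2 ^ Suc k) ^ n"
            by (subst powr_minus, subst inverse_powr) (simp_all only: powr_realpow inverse_inverse_eq zero_less_power zero_less_numeral zero_le_power zero_le_numeral)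
          ultimately show ?thesis unfolding a_def pw by simp
        qed
        finally have "ennreal (f z) \<le> ennreal (a k)" by (rule ennreal_leI)
        moreover have "ennreal (a k) \<le> S k z" using k' by (simp add: S_def r_def)
        ultimately show ?thesis using order_trans by blast
      qed
    qed
    then obtain k where "ennreal (f z) \<le> S k z" by blast
    also have "\<dots> \<le> (\<Sum>k. S k z)" using sum_le_suminf[of "\<lambda>k. S k z" "{k}"] by simp
    finally show ?thesis .
  qed
  define w where "w = unit_ball_vol (real n)"
  have w0: "0 \<le> w" unfolding w_def by simp
  have intS: "(\<integral>\<^sup>+z. S k z \<partial>lborel) = ennreal (w * 2 ^ n * ((2 powr (-(2 - 2 * \<sigma>))) ^ k + (2 powr (-2 * \<sigma>)) ^ k))" for k
  proof -
    have "(\<integral>\<^sup>+z. S k z \<partial>lborel) = ennreal (a k) * ennreal (w * inverse (2 ^ k) ^ n) + ennreal (b k) * ennreal (w * (2 ^ Suc k) ^ n)"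
      unfolding S_def
      by (subst nn_integral_add; (subst nn_integral_cmult_indicator)?; (subst nn_integral_cmult_indicator)?)
         (auto simp: emeasure_cball w_def n_def intro!: borel_measurable_times_ennreal borel_measurable_indicator)
    also have "\<dots> = ennreal (a k * (w * inverse (2 ^ k) ^ n) + b k * (w * (2 ^ Suc k) ^ n))"
      using a0 b0 w0 by (simp add: ennreal_mult' ennreal_plus)
    also have "a k * (w * inverse (2 ^ k) ^ n) + b k * (w * (2 ^ Suc k) ^ n)
      = w * 2 ^ n * ((2 powr (-(2 - 2 * \<sigma>))) ^ k + (2 powr (-2 * \<sigma>)) ^ k)"
      by (simp add: a_def b_def power_mult_distrib field_simps)
    finally show ?thesis .
  qed
  have "2 powr (-(2 - 2 * \<sigma>)) < 1" "2 powr (-2 * \<sigma>) < (1::real)"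
    using assms powr_less_one[of 2 "-(2 - 2 * \<sigma>)"] powr_less_one[of 2 "-2 * \<sigma>"] by (simp_all add: algebra_simps)
  then have sm: "summable (\<lambda>k. w * 2 ^ n * ((2 powr (-(2 - 2 * \<sigma>))) ^ k + (2 powr (-2 * \<sigma>)) ^ k))"
    by (intro summable_mult summable_add summable_geometric) simp_all
  have "(\<integral>\<^sup>+z. ennreal (f z) \<partial>lborel) \<le> (\<integral>\<^sup>+z. (\<Sum>k. S k z) \<partial>lborel)"
    by (intro nn_integral_mono bd)
  also have "\<dots> = (\<Sum>k. \<integral>\<^sup>+z. S k z \<partial>lborel)"
    by (rule nn_integral_suminf)
       (auto simp: S_def intro!: borel_measurable_add borel_measurable_times_ennreal borel_measurable_indicator)
  also have "\<dots> = (\<Sum>k. ennreal (w * 2 ^ n * ((2 powr (-(2 - 2 * \<sigma>))) ^ k + (2 powr (-2 * \<sigma>)) ^ k)))"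
    by (simp only: intS)
  also have "\<dots> < \<infinity>"
    by (subst suminf_ennreal2[OF _ sm]) (use w0 in auto)
  finally have "integrable lborel f"
    using f0 by (intro integrableI_nonneg) auto
  then show ?thesis unfolding f_def n_def .
qed


text \<open>The substitution z = R w. The decay R^(-2\<sigma>) = R^(-\<beta>) of the fractional
  Laplacian of the cutoff originates here.\<close>

lemma integral_frac_kernel_scale:
  fixes \<sigma> R :: real
  assumes "0 < R"
  defines "k \<equiv> \<lambda>z::'a::euclidean_space. min ((norm z)\<^sup>2) 1 / norm z powr (real DIM('a) + 2 * \<sigma>)"
  shows "(LINT z::'a|lborel. min ((norm z / R)\<^sup>2) 1 / norm z powr (real DIM('a) + 2 * \<sigma>)) =
      R powr (-2 * \<sigma>) * (LINT z|lborel. k z)"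
    and "integrable lborel (\<lambda>z::'a. min ((norm z / R)\<^sup>2) 1 / norm z powr (real DIM('a) + 2 * \<sigma>)) \<longleftrightarrow>
      integrable lborel k"
proof -
  define h where "h = (\<lambda>z::'a. min ((norm z / R)\<^sup>2) 1 / norm z powr (real DIM('a) + 2 * \<sigma>))"
  have [measurable]: "h \<in> borel_measurable borel" unfolding h_def by measurable
  have hk: "h (0 + R *\<^sub>R w) = R powr (-(real DIM('a) + 2 * \<sigma>)) * k w" for w
    using assms(1) by (simp add: h_def k_def powr_mult powr_minus_divide del: minus_add_distrib)
  have "R ^ DIM('a) * R powr (-(real DIM('a) + 2 * \<sigma>)) = R powr (-2 * \<sigma>)"
    using assms(1) by (simp add: powr_realpow[symmetric] powr_add[symmetric])
  then have "integral\<^sup>L lborel h = R powr (-2 * \<sigma>) * integral\<^sup>L lborel k"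
    using assms(1) by (subst integral_lborel_affine[of h R 0]) (simp_all add: hk mult.assoc[symmetric] del: add_0)
  moreover have "integrable lborel h \<longleftrightarrow> integrable lborel k"
    using assms(1) by (subst integrable_lborel_affine[of h R 0]) (simp_all add: hk del: add_0)
  ultimately show "(LINT z::'a|lborel. min ((norm z / R)\<^sup>2) 1 / norm z powr (real DIM('a) + 2 * \<sigma>)) =
      R powr (-2 * \<sigma>) * (LINT z|lborel. k z)"
    "integrable lborel (\<lambda>z::'a. min ((norm z / R)\<^sup>2) 1 / norm z powr (real DIM('a) + 2 * \<sigma>)) \<longleftrightarrow>
      integrable lborel k"
    unfolding h_def by auto
qed

text \<open>Averaging the truncated integral over y = x + z and y = x - z replaces the first
  difference of \<open>v\<close> by half its second difference. By \<open>D2\<close> this is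
  dominated by an integrable kernel uniformly in the truncation radius, so dominated convergence
  gives both the limit and its bound.\<close>

lemma frac_laplacian_pv:
  fixes v :: "real^'n \<Rightarrow> real" and \<sigma> R A :: real
  assumes \<sigma>: "0 < \<sigma>" "\<sigma> < 1" and R: "0 < R"
    and v [measurable]: "v \<in> borel_measurable borel" and vB: "\<And>y. \<bar>v y\<bar> \<le> B"
    and D2: "\<And>z. \<bar>2 * v x - v (x + z) - v (x - z)\<bar> \<le> A * min ((norm z / R)\<^sup>2) 1"
  defines "k \<equiv> \<lambda>z::real^'n. min ((norm z)\<^sup>2) 1 / norm z powr (real CARD('n) + 2 * \<sigma>)"
    and "I \<equiv> \<lambda>\<delta>. LINT y : - ball x \<delta> | lebesgue. (v x - v y) / norm (x - y) powr (real CARD('n) + 2 * \<sigma>)"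
  shows "\<exists>L \<le> A / 2 * R powr (-2 * \<sigma>) * integral\<^sup>L lborel k. (I \<longlongrightarrow> L) (at_right 0)"
proof -
  define a where "a = real CARD('n) + 2 * \<sigma>"
  define G where "G z = (v x - v (x + z)) / norm z powr a" for z
  define S where "S z = (2 * v x - v (x + z) - v (x - z)) / 2 / norm z powr a" for z
  define h where "h z = min ((norm z / R)\<^sup>2) 1 / norm z powr a" for z :: "real^'n"
  have [measurable]: "G \<in> borel_measurable borel" "S \<in> borel_measurable borel" "k \<in> borel_measurable borel"
    "h \<in> borel_measurable borel"
    unfolding G_def S_def k_def h_def by measurable
  have k_int: "integrable lborel k"
    unfolding k_def using integrable_frac_kernel[OF \<sigma>, where 'a="real^'n"] by simp
  have h_int: "integrable lborel h" and h_eq: "integral\<^sup>L lborel h = R powr (-2 * \<sigma>) * integral\<^sup>L lborel k"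
    using integral_frac_kernel_scale[OF R, of \<sigma>, where 'a="real^'n"] k_int unfolding k_def h_def a_def by simp_all
  have S_le: "\<bar>S z\<bar> \<le> A / 2 * h z" for z
    using divide_right_mono[OF D2[of z], of "2 * norm z powr a"] by (simp add: S_def h_def abs_divide)
  have S_int: "integrable lborel S"
    by (rule Bochner_Integration.integrable_bound[of _ "\<lambda>z. A / 2 * h z"])
       (use h_int in \<open>auto intro!: AE_I2 simp del: abs_mult intro: order_trans[OF S_le abs_ge_self, simplified]\<close>)
  have I_eq: "I \<delta> = (LINT z|lborel. indicator (- ball 0 \<delta>) z * S z)" if \<delta>: "0 < \<delta>" for \<delta>
  proof -
    \<comment> \<open>Before symmetrisation the first difference is only bounded by
      \<open>2 * B\<close>. Off the ball of radius \<delta> that is enough, because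
      min(\<bar>z\<bar>^2, 1) \<ge> c there.\<close>
    define c where "c = min (\<delta>\<^sup>2) 1"
    have c: "0 < c" using \<delta> by (simp add: c_def)
    define H where "H z = indicator (- ball 0 \<delta>) z * G z" for z
    have [measurable]: "H \<in> borel_measurable borel" unfolding H_def by measurable
    have H_le: "\<bar>H z\<bar> \<le> 2 * B / c * k z" for z
    proof (cases "norm z < \<delta>")
      case True
      have "0 \<le> B" using vB[of 0] by linarith
      then show ?thesis using True c by (simp add: H_def k_def)
    next
      case False
      have "0 \<le> B" using vB[of 0] by linarith
      have "c \<le> min ((norm z)\<^sup>2) 1" using False \<delta> by (simp add: c_def min.coboundedI1 power_mono)
      then have "1 \<le> min ((norm z)\<^sup>2) 1 / c" using c by simp
      then have "2 * B * 1 \<le> 2 * B * (min ((norm z)\<^sup>2) 1 / c)" using \<open>0 \<le> B\<close> by (intro mult_left_mono) auto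
      moreover have "\<bar>v x - v (x + z)\<bar> \<le> 2 * B" using vB[of x] vB[of "x + z"] by linarith
      ultimately have "\<bar>v x - v (x + z)\<bar> / norm z powr a \<le> 2 * B * (min ((norm z)\<^sup>2) 1 / c) / norm z powr a"
        by (intro divide_right_mono) auto
      then show ?thesis using False by (simp add: H_def G_def k_def a_def abs_divide)
    qed
    have H_int: "integrable lborel H"
      by (intro Bochner_Integration.integrable_bound[of _ "\<lambda>z. 2 * B / c * k z" H])
         (use k_int in \<open>auto intro!: AE_I2 intro: order_trans[OF H_le abs_ge_self, simplified]\<close>)
    have H_int': "integrable lborel (\<lambda>z. H (- z))"
      using integrable_lborel_affine[of H "-1" 0] H_int by simp
    have "I \<delta> = (LINT y|lebesgue. H (y - x))"
      unfolding I_def set_lebesgue_integral_def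
      by (intro Bochner_Integration.integral_cong refl)
         (auto simp: H_def G_def a_def indicator_def dist_norm norm_minus_commute)
    also have "\<dots> = (LINT y|lborel. H (y - x))" by (simp add: integral_completion)
    also have "\<dots> = integral\<^sup>L lborel H" by (subst integral_lborel_affine[of _ 1 x]) simp_all
    finally have 1: "I \<delta> = integral\<^sup>L lborel H" .
    have 2: "(LINT z|lborel. H (- z)) = integral\<^sup>L lborel H"
      using integral_lborel_affine[of H "-1" 0] by simp
    have "(LINT z|lborel. indicator (- ball 0 \<delta>) z * S z) = (LINT z|lborel. (H z + H (- z)) / 2)"
      by (intro Bochner_Integration.integral_cong refl)
         (auto simp: H_def G_def S_def indicator_def diff_divide_distrib add_divide_distrib)
    also have "\<dots> = integral\<^sup>L lborel H"
      using H_int H_int' 2 by simp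
    finally show ?thesis using 1 by simp
  qed
  have lim: "(I \<longlongrightarrow> integral\<^sup>L lborel S) (at_right 0)"
  proof (rule tendsto_at_right_sequentially[of 0 1])
    fix s :: "nat \<Rightarrow> real"
    assume s: "\<And>n. 0 < s n" "s \<longlonglongrightarrow> 0"
    have "(\<lambda>n. LINT z|lborel. indicator (- ball 0 (s n)) z * S z) \<longlonglongrightarrow> integral\<^sup>L lborel S"
    proof (rule integral_dominated_convergence[where w = "\<lambda>z. \<bar>S z\<bar>"])
      show "AE z in lborel. (\<lambda>n. indicator (- ball 0 (s n)) z * S z) \<longlonglongrightarrow> S z"
      proof (intro AE_I2)
        fix z :: "real^'n"
        show "(\<lambda>n. indicator (- ball 0 (s n)) z * S z) \<longlonglongrightarrow> S z"
        proof (cases "z = 0")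
          case False
          then have "eventually (\<lambda>n. s n < norm z) sequentially"
            using order_tendstoD(2)[OF s(2)] by simp
          then have "eventually (\<lambda>n. indicator (- ball 0 (s n)) z * S z = S z) sequentially"
            by eventually_elim simp
          then show ?thesis by (rule tendsto_eventually)
        qed (simp add: S_def)
      qed
    qed (use S_int in \<open>auto simp: indicator_def\<close>)
    then show "(\<lambda>n. I (s n)) \<longlonglongrightarrow> integral\<^sup>L lborel S" using s by (simp add: I_eq)
  qed simp
  have "integral\<^sup>L lborel S \<le> (LINT z|lborel. A / 2 * h z)"
    using S_int h_int by (intro integral_mono order_trans[OF abs_ge_self S_le]) auto
  also have "\<dots> = A / 2 * R powr (-2 * \<sigma>) * integral\<^sup>L lborel k" using h_eq by simp
  finally show ?thesis using lim by blast
qed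

lemma frac_const_nonneg: "0 \<le> \<sigma> \<Longrightarrow> 0 < n \<Longrightarrow> 0 \<le> frac_const n \<sigma>"
  unfolding frac_const_def by (simp add: less_imp_le Gamma_real_pos add_pos_nonneg)

text \<open>One constant has to serve all \<open>v\<close>, \<open>x\<close> and \<open>R\<close>,
  since the time weight will sit inside \<open>v\<close>. At a zero of a nonnegative
  \<open>v\<close> every truncated integrand is nonpositive, hence so is the limit.\<close>

lemma ex_frac_laplacian_bound:
  fixes \<sigma> :: real
  assumes \<sigma>: "0 < \<sigma>" "\<sigma> < 1"
  shows "\<exists>C>0. \<forall>(v::real^'n \<Rightarrow> real) x R A B. 0 < R \<longrightarrow> 0 \<le> A \<longrightarrow> v \<in> borel_measurable borel \<longrightarrow> (\<forall>y. 0 \<le> v y \<and> v y \<le> B) \<longrightarrow>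
     (\<forall>z. \<bar>2 * v x - v (x + z) - v (x - z)\<bar> \<le> A * min ((norm z / R)\<^sup>2) 1) \<longrightarrow>
     frac_laplacian \<sigma> v x \<le> C * A * R powr (-2 * \<sigma>) \<and> (v x = 0 \<longrightarrow> frac_laplacian \<sigma> v x \<le> 0)"
proof -
  define J where "J = (LINT z::real^'n|lborel. min ((norm z)\<^sup>2) 1 / norm z powr (real CARD('n) + 2 * \<sigma>))"
  define c where "c = frac_const CARD('n) \<sigma>"
  have c: "0 \<le> c" unfolding c_def using \<sigma> by (intro frac_const_nonneg) auto
  have J: "0 \<le> J" unfolding J_def by (intro integral_nonneg_AE) auto
  show ?thesis
  proof (intro exI[of _ "c * J + 1"] conjI allI impI)
    fix v :: "real^'n \<Rightarrow> real" and x R A B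
    assume R: "0 < R" and A: "0 \<le> A" and v: "v \<in> borel_measurable borel" and vB: "\<forall>y. 0 \<le> v y \<and> v y \<le> B"
      and D2: "\<forall>z. \<bar>2 * v x - v (x + z) - v (x - z)\<bar> \<le> A * min ((norm z / R)\<^sup>2) 1"
    define I where "I \<delta> = (LINT y : - ball x \<delta> | lebesgue. (v x - v y) / norm (x - y) powr (real CARD('n) + 2 * \<sigma>))" for \<delta>
    obtain L where L: "L \<le> A / 2 * R powr (-2 * \<sigma>) * J" "(I \<longlongrightarrow> L) (at_right 0)"
      using frac_laplacian_pv[OF \<sigma> R v, of B x A] vB D2 unfolding J_def I_def by auto
    have eq: "frac_laplacian \<sigma> v x = c * L"
      unfolding frac_laplacian_def c_def using tendsto_Lim[OF _ L(2)[unfolded I_def]] by simp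
    have "c * L \<le> c * (A / 2 * R powr (-2 * \<sigma>) * J)" by (rule mult_left_mono[OF L(1) c])
    also have "\<dots> \<le> (c * J + 1) * A * R powr (-2 * \<sigma>)"
    proof -
      have "c * J / 2 * (A * R powr (-2 * \<sigma>)) \<le> (c * J + 1) * (A * R powr (-2 * \<sigma>))"
        using c J A by (intro mult_right_mono) auto
      then show ?thesis by (simp add: mult_ac)
    qed
    finally show "frac_laplacian \<sigma> v x \<le> (c * J + 1) * A * R powr (-2 * \<sigma>)" using eq by simp
    assume v0: "v x = 0"
    have "I \<delta> \<le> 0" for \<delta>
    proof -
      have "0 \<le> - I \<delta>"
        unfolding I_def set_lebesgue_integral_def Bochner_Integration.integral_minus[symmetric] using vB v0
        by (intro integral_nonneg_AE AE_I2) (auto simp: indicator_def)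
      then show ?thesis by simp
    qed
    then have "L \<le> 0"
      using L(2) by (intro tendsto_upperbound[of I L "at_right 0"]) auto
    then show "frac_laplacian \<sigma> v x \<le> 0" using eq c by (simp add: mult_nonneg_nonpos)
  qed (use c J in \<open>simp add: add_nonneg_pos\<close>)
qed

section \<open>Cutoff functions\<close>

lemma DERIV_pos_part_power:
  fixes z :: real
  shows "((\<lambda>z. max 0 z ^ Suc (Suc k)) has_real_derivative real (Suc (Suc k)) * max 0 z ^ Suc k) (at z)"
proof -
  consider "z > 0" | "z < 0" | "z = 0" by linarith
  then show ?thesis
  proof cases
    case 1
    have "((\<lambda>z. z ^ Suc (Suc k)) has_real_derivative real (Suc (Suc k)) * z ^ Suc k) (at z)"
      using DERIV_pow[of "Suc (Suc k)" z] by simp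
    then show ?thesis
      using 1 by (subst has_field_derivative_cong_eventually[where g = "\<lambda>z. z ^ Suc (Suc k)"])
        (auto intro: eventually_at_in_open'[of "{0<..}", THEN eventually_mono] simp: max_def eventually_at_filter
           intro!: eventually_nhds_in_open[of "{0<..}", THEN eventually_mono])
  next
    case 2
    show ?thesis
      using 2 by (subst has_field_derivative_cong_eventually[where g = "\<lambda>z. 0"])
        (auto simp: max_def eventually_at_filter
           intro!: eventually_nhds_in_open[of "{..<0}", THEN eventually_mono])
  next
    case 3
    have "((\<lambda>h::real. max 0 h ^ Suc (Suc k) / h) \<longlongrightarrow> 0) (at 0)"
    proof (rule Lim_null_comparison[where g = "\<lambda>h. \<bar>h\<bar> ^ Suc k"])
      have "norm (max 0 h ^ Suc (Suc k) / h) \<le> \<bar>h\<bar> ^ Suc k" for h :: real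
        by (cases "h > 0") (simp_all add: max_absorb1 max_absorb2 mult_nonpos_nonneg)
      then show "eventually (\<lambda>h::real. norm (max 0 h ^ Suc (Suc k) / h) \<le> \<bar>h\<bar> ^ Suc k) (at 0)"
        by simp
      show "((\<lambda>h::real. \<bar>h\<bar> ^ Suc k) \<longlongrightarrow> 0) (at 0)"
        by (auto intro!: tendsto_eq_intros)
    qed
    then show ?thesis using 3 by (simp add: DERIV_def)
  qed
qed

text \<open>A piecewise polynomial cutoff, so that all derivatives are explicit. The cube of a
  positive part is C^2: the inner cube glues the profile to 1 at s = 1, the outer one glues it to 0
  at s = 2.\<close>

definition profile :: "real \<Rightarrow> real" where
  "profile s = max 0 (1 - max 0 (s - 1) ^ 3) ^ 3"

definition profile' :: "real \<Rightarrow> real" where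
  "profile' s = - (9 * max 0 (1 - max 0 (s - 1) ^ 3) ^ 2 * max 0 (s - 1) ^ 2)"

definition profile'' :: "real \<Rightarrow> real" where
  "profile'' s = 54 * max 0 (1 - max 0 (s - 1) ^ 3) * max 0 (s - 1) ^ 4
    - 18 * max 0 (1 - max 0 (s - 1) ^ 3) ^ 2 * max 0 (s - 1)"

lemma DERIV_pos_part_cube [derivative_intros]:
  "(f has_real_derivative f') (at x within S) \<Longrightarrow>
    ((\<lambda>x. max 0 (f x) ^ 3) has_real_derivative 3 * max 0 (f x) ^ 2 * f') (at x within S)"
  using DERIV_chain2[OF DERIV_pos_part_power[of 1]] by (simp add: numeral_eq_Suc)

lemma DERIV_pos_part_square [derivative_intros]:
  "(f has_real_derivative f') (at x within S) \<Longrightarrow>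
    ((\<lambda>x. max 0 (f x) ^ 2) has_real_derivative 2 * max 0 (f x) * f') (at x within S)"
  using DERIV_chain2[OF DERIV_pos_part_power[of 0]] by (simp add: numeral_eq_Suc)

lemma DERIV_profile:
  "(f has_real_derivative f') (at x within S) \<Longrightarrow>
    ((\<lambda>x. profile (f x)) has_real_derivative profile' (f x) * f') (at x within S)"
  unfolding profile_def profile'_def
  by (rule derivative_eq_intros refl | assumption)+ simp

lemma DERIV_profile':
  "(f has_real_derivative f') (at x within S) \<Longrightarrow>
    ((\<lambda>x. profile' (f x)) has_real_derivative profile'' (f x) * f') (at x within S)"
  unfolding profile'_def profile''_def
  by (rule derivative_eq_intros refl | assumption)+ (simp add: algebra_simps power2_eq_square power4_eq_xxxx)

lemma continuous_on_profile [continuous_intros]: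
  assumes "continuous_on S f"
  shows "continuous_on S (\<lambda>x. profile (f x))" "continuous_on S (\<lambda>x. profile' (f x))" "continuous_on S (\<lambda>x. profile'' (f x))"
  unfolding profile_def profile'_def profile''_def using assms by (auto intro!: continuous_intros)

lemma profile_simps:
  "s \<le> 1 \<Longrightarrow> profile s = 1" "2 \<le> s \<Longrightarrow> profile s = 0" "2 \<le> s \<Longrightarrow> profile' s = 0" "2 \<le> s \<Longrightarrow> profile'' s = 0"
proof -
  have "max 0 (1 - max 0 (s - 1) ^ 3) = 0" if "2 \<le> s"
    using that one_le_power[of "max 0 (s - 1)" 3] by simp
  then show "2 \<le> s \<Longrightarrow> profile s = 0" "2 \<le> s \<Longrightarrow> profile' s = 0" "2 \<le> s \<Longrightarrow> profile'' s = 0"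
    by (simp_all add: profile_def profile'_def profile''_def)
qed (simp add: profile_def)

lemma profile_nonneg: "0 \<le> profile s" and profile_le_1: "profile s \<le> 1"
  unfolding profile_def by (auto intro!: power_le_one simp: max_def)

lemma profile_antimono: "s \<le> t \<Longrightarrow> profile t \<le> profile s"
  unfolding profile_def by (intro power_mono max.mono diff_mono order_refl) auto

lemma profile_eq_0_iff: "profile s = 0 \<longleftrightarrow> 2 \<le> s"
proof
  assume "profile s = 0"
  then have "1 \<le> max 0 (s - 1) ^ 3" by (auto simp: profile_def max_def split: if_splits)
  then have "1 \<le> max 0 (s - 1)" using power_less_one_iff[of "max 0 (s - 1)" 3] by (auto simp: not_less[symmetric])
  then show "2 \<le> s" by (auto simp: max_def split: if_splits)
qed (simp add: profile_simps)

text \<open>For s < 2 both positive parts lie in [0,1], so the bounds are read off the coefficients: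
  9, and 54 + 18 = 72. For s \<ge> 2 both derivatives vanish.\<close>

lemma profile_derivs_bound: "\<bar>profile' s\<bar> \<le> 9" "\<bar>profile'' s\<bar> \<le> 72"
proof -
  define a where "a = max 0 (1 - max 0 (s - 1) ^ 3)"
  define b where "b = max 0 (s - 1)"
  have "\<bar>profile' s\<bar> \<le> 9 \<and> \<bar>profile'' s\<bar> \<le> 72"
  proof (cases "2 \<le> s")
    case False
    have a: "0 \<le> a" "a \<le> 1" unfolding a_def by auto
    have b: "0 \<le> b" "b \<le> 1" unfolding b_def using False by auto
    have 1: "a ^ 2 * b ^ 2 \<le> 1" "0 \<le> a ^ 2 * b ^ 2" "a * b ^ 4 \<le> 1" "0 \<le> a * b ^ 4" "a ^ 2 * b \<le> 1" "0 \<le> a ^ 2 * b"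
      using a b by (auto intro!: mult_le_one power_le_one)
    have "profile' s = - 9 * (a ^ 2 * b ^ 2)" "profile'' s = 54 * (a * b ^ 4) - 18 * (a ^ 2 * b)"
      by (simp_all add: profile'_def profile''_def a_def b_def)
    then show ?thesis using 1 by linarith
  qed (simp add: profile_simps)
  then show "\<bar>profile' s\<bar> \<le> 9" "\<bar>profile'' s\<bar> \<le> 72" by auto
qed

text \<open>The squared norm as argument avoids the kink of the norm at the origin. The cutoff then
  vanishes from radius sqrt(2) R on, well inside the ball of radius 2R used below.\<close>

definition cutoff :: "real \<Rightarrow> 'a::real_inner \<Rightarrow> real" where
  "cutoff R x = profile ((norm x / R)\<^sup>2)"

text \<open>Directional derivatives along arbitrary vectors: coordinate directions serve the
  Laplacian and the test function class, while the direction of the shift serves second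
  differences.\<close>

definition cutoff_d1 :: "real \<Rightarrow> 'a::real_inner \<Rightarrow> 'a \<Rightarrow> real" where
  "cutoff_d1 R z x = profile' ((norm x / R)\<^sup>2) * (2 * (x \<bullet> z) / R\<^sup>2)"

definition cutoff_d2 :: "real \<Rightarrow> 'a::real_inner \<Rightarrow> 'a \<Rightarrow> 'a \<Rightarrow> real" where
  "cutoff_d2 R z w x = profile'' ((norm x / R)\<^sup>2) * (2 * (x \<bullet> z) / R\<^sup>2) * (2 * (x \<bullet> w) / R\<^sup>2)
     + profile' ((norm x / R)\<^sup>2) * (2 * (z \<bullet> w) / R\<^sup>2)"

lemma DERIV_norm_square_line:
  fixes x w :: "'a::real_inner"
  shows "((\<lambda>h. (norm (x + h *\<^sub>R w) / R)\<^sup>2) has_real_derivative 2 * ((x + h *\<^sub>R w) \<bullet> w) / R\<^sup>2) (at h)"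
proof -
  have eq: "(norm (x + h *\<^sub>R w) / R)\<^sup>2 = (x \<bullet> x + 2 * h * (x \<bullet> w) + h\<^sup>2 * (w \<bullet> w)) / R\<^sup>2" for h
    unfolding power_divide power2_norm_eq_inner
    by (simp add: inner_add_left inner_add_right inner_commute power2_eq_square algebra_simps)
  have "((\<lambda>h. x \<bullet> x + 2 * h * (x \<bullet> w) + h\<^sup>2 * (w \<bullet> w)) has_real_derivative 2 * ((x + h *\<^sub>R w) \<bullet> w)) (at h)"
    by (auto intro!: derivative_eq_intros simp: inner_add_left algebra_simps)
  then show ?thesis unfolding eq by (rule DERIV_cdivide)
qed

lemma DERIV_cutoff_line:
  "((\<lambda>h. cutoff R (x + h *\<^sub>R z)) has_real_derivative cutoff_d1 R z (x + h *\<^sub>R z)) (at h)"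
  unfolding cutoff_def cutoff_d1_def by (intro DERIV_profile DERIV_norm_square_line)

lemma DERIV_cutoff_d1_line:
  "((\<lambda>h. cutoff_d1 R z (x + h *\<^sub>R w)) has_real_derivative cutoff_d2 R z w (x + h *\<^sub>R w)) (at h)"
proof -
  have 1: "((\<lambda>h. 2 * ((x + h *\<^sub>R w) \<bullet> z) / R\<^sup>2) has_real_derivative 2 * (z \<bullet> w) / R\<^sup>2) (at h)"
    unfolding inner_add_left inner_scaleR_left
    by (rule DERIV_cdivide) (auto intro!: derivative_eq_intros simp: inner_commute)
  show ?thesis
    unfolding cutoff_d1_def cutoff_d2_def
    by (rule DERIV_cong[OF DERIV_mult[OF DERIV_profile'[OF DERIV_norm_square_line] 1]]) (simp only: mult_ac)
qed

lemma cutoff_nonneg: "0 \<le> cutoff R x" and cutoff_le_1: "cutoff R x \<le> 1"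
  unfolding cutoff_def by (rule profile_nonneg, rule profile_le_1)

lemma cutoff_eq_1: "0 < R \<Longrightarrow> norm x \<le> R \<Longrightarrow> cutoff R x = 1"
  unfolding cutoff_def by (intro profile_simps) (simp add: power_le_one)

lemma cutoff_eq_0_iff: "cutoff R x = 0 \<longleftrightarrow> 2 \<le> (norm x / R)\<^sup>2"
  unfolding cutoff_def by (rule profile_eq_0_iff)

lemma cutoff_eq_0:
  assumes "0 < R" "2 * R \<le> norm x"
  shows "cutoff R x = 0"
proof -
  have "2 \<le> norm x / R" using assms by (simp add: field_simps)
  then have "2\<^sup>2 \<le> (norm x / R)\<^sup>2" by (intro power_mono) auto
  then show ?thesis by (simp add: cutoff_eq_0_iff)
qed

text \<open>The factor \<bar>x\<bar>^2 / R^4 of the first summand is at most 2 / R^2, because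
  \<open>profile''\<close> vanishes once (\<bar>x\<bar> / R)^2 \<ge> 2. The constant is 72 * 4 * 2 +
  9 * 2 = 594.\<close>

lemma cutoff_d2_bound:
  assumes R: "0 < R"
  shows "\<bar>cutoff_d2 R z w x\<bar> \<le> 594 * norm z * norm w / R\<^sup>2"
proof -
  define s where "s = (norm x / R)\<^sup>2"
  have 1: "\<bar>profile'' s * (2 * (x \<bullet> z) / R\<^sup>2) * (2 * (x \<bullet> w) / R\<^sup>2)\<bar> \<le> 576 * norm z * norm w / R\<^sup>2"
  proof (cases "2 \<le> s")
    case False
    have "\<bar>profile'' s * (2 * (x \<bullet> z) / R\<^sup>2) * (2 * (x \<bullet> w) / R\<^sup>2)\<bar>
      = \<bar>profile'' s\<bar> * (2 * \<bar>x \<bullet> z\<bar> / R\<^sup>2) * (2 * \<bar>x \<bullet> w\<bar> / R\<^sup>2)"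
      by (simp add: abs_mult)
    also have "\<dots> \<le> 72 * (2 * (norm x * norm z) / R\<^sup>2) * (2 * (norm x * norm w) / R\<^sup>2)"
      by (intro mult_mono divide_right_mono mult_left_mono profile_derivs_bound Cauchy_Schwarz_ineq2) auto
    also have "\<dots> = s * (288 * norm z * norm w / R\<^sup>2)"
      by (simp add: s_def power_divide power2_eq_square)
    also have "\<dots> \<le> 2 * (288 * norm z * norm w / R\<^sup>2)"
      using False by (intro mult_right_mono) auto
    finally show ?thesis by simp
  qed (simp add: profile_simps)
  have "\<bar>profile' s * (2 * (z \<bullet> w) / R\<^sup>2)\<bar> = \<bar>profile' s\<bar> * (2 * \<bar>z \<bullet> w\<bar> / R\<^sup>2)"
    by (simp add: abs_mult)
  also have "\<dots> \<le> 9 * (2 * (norm z * norm w) / R\<^sup>2)"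
    by (intro mult_mono divide_right_mono mult_left_mono profile_derivs_bound Cauchy_Schwarz_ineq2) auto
  finally have 2: "\<bar>profile' s * (2 * (z \<bullet> w) / R\<^sup>2)\<bar> \<le> 18 * norm z * norm w / R\<^sup>2" by simp
  have "\<bar>cutoff_d2 R z w x\<bar> \<le> 576 * norm z * norm w / R\<^sup>2 + 18 * norm z * norm w / R\<^sup>2"
    unfolding cutoff_d2_def s_def[symmetric] by (intro order_trans[OF abs_triangle_ineq] add_mono 1 2)
  then show ?thesis by (simp add: add_divide_distrib[symmetric] ac_simps)
qed

text \<open>Taylor expansion to second order with Lagrange remainder, for \<open>f\<close> and for
  its reflection: in the sum the first-order terms cancel and two values of \<open>f''\<close> with
  weight 1/2 remain.\<close>

lemma second_difference_bound:
  fixes f f' f'' :: "real \<Rightarrow> real"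
  assumes f: "\<And>s. (f has_real_derivative f' s) (at s)"
    and f': "\<And>s. (f' has_real_derivative f'' s) (at s)" and B: "\<And>s. \<bar>f'' s\<bar> \<le> B"
  shows "\<bar>2 * f 0 - f 1 - f (-1)\<bar> \<le> B"
proof -
  define d where "d m = (if m = 0 then f else if m = 1 then f' else f'')" for m :: nat
  define e where "e m s = (-1) ^ m * d m (- s)" for m :: nat and s
  have "\<exists>t>0. t \<le> 1 \<and> f 1 = (\<Sum>m<2. d m 0 / fact m * 1 ^ m) + d 2 t / fact 2 * 1 ^ 2"
  proof (rule Maclaurin2)
    show "\<forall>m t. m < 2 \<and> 0 \<le> t \<and> t \<le> 1 \<longrightarrow> (d m has_real_derivative d (Suc m) t) (at t)"
      using f f' by (auto simp: d_def less_2_cases_iff)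
  qed (simp_all add: d_def)
  then have 1: "\<exists>t. f 1 = f 0 + f' 0 + f'' t / 2"
    by (auto simp: d_def numeral_2_eq_2)
  have "\<exists>t>0. t \<le> 1 \<and> (\<lambda>s. f (- s)) 1 = (\<Sum>m<2. e m 0 / fact m * 1 ^ m) + e 2 t / fact 2 * 1 ^ 2"
  proof (rule Maclaurin2)
    show "e 0 = (\<lambda>s. f (- s))" by (simp add: e_def d_def fun_eq_iff)
    show "\<forall>m t. m < 2 \<and> 0 \<le> t \<and> t \<le> 1 \<longrightarrow> (e m has_real_derivative e (Suc m) t) (at t)"
      using DERIV_mirror[THEN iffD1, OF f] DERIV_minus[OF DERIV_mirror[THEN iffD1, OF f']]
      by (auto simp: e_def[abs_def] d_def less_2_cases_iff)
  qed simp
  then have 2: "\<exists>t. f (- 1) = f 0 - f' 0 + f'' t / 2"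
    by (auto simp: e_def d_def numeral_2_eq_2)
  obtain s t where st: "f 1 = f 0 + f' 0 + f'' s / 2" "f (- 1) = f 0 - f' 0 + f'' t / 2"
    using 1 2 by blast
  show ?thesis using B[of s] B[of t] unfolding st by linarith
qed

text \<open>Taylor gives the quadratic bound, useful for small shifts; for large ones the values in
  [0,1] give the bound 2, which 594 covers.\<close>

lemma cutoff_second_difference:
  fixes x z :: "'a::real_inner"
  assumes R: "0 < R"
  shows "\<bar>2 * cutoff R x - cutoff R (x + z) - cutoff R (x - z)\<bar> \<le> 594 * min ((norm z / R)\<^sup>2) 1"
proof -
  have "\<bar>2 * cutoff R (x + 0 *\<^sub>R z) - cutoff R (x + 1 *\<^sub>R z) - cutoff R (x + (-1) *\<^sub>R z)\<bar> \<le> 594 * norm z * norm z / R\<^sup>2"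
    using cutoff_d2_bound[OF R]
    by (intro second_difference_bound[where f = "\<lambda>h. cutoff R (x + h *\<^sub>R z)"
          and f' = "\<lambda>h. cutoff_d1 R z (x + h *\<^sub>R z)" and f'' = "\<lambda>h. cutoff_d2 R z z (x + h *\<^sub>R z)"]
        DERIV_cutoff_line DERIV_cutoff_d1_line)
  then have "\<bar>2 * cutoff R x - cutoff R (x + z) - cutoff R (x - z)\<bar> \<le> 594 * (norm z / R)\<^sup>2"
    by (simp add: power_divide power2_eq_square)
  moreover have "\<bar>2 * cutoff R x - cutoff R (x + z) - cutoff R (x - z)\<bar> \<le> 2"
    using cutoff_nonneg[of R x] cutoff_nonneg[of R "x + z"] cutoff_nonneg[of R "x - z"]
      cutoff_le_1[of R x] cutoff_le_1[of R "x + z"] cutoff_le_1[of R "x - z"] by linarith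
  ultimately show ?thesis by (auto simp: min_def)
qed

lemma continuous_on_cutoff [continuous_intros]:
  assumes "continuous_on S f" "R \<noteq> 0"
  shows "continuous_on S (\<lambda>x. cutoff R (f x))" "continuous_on S (\<lambda>x. cutoff_d1 R z (f x))" "continuous_on S (\<lambda>x. cutoff_d2 R z w (f x))"
  unfolding cutoff_def cutoff_d1_def cutoff_d2_def using assms by (auto intro!: continuous_intros)

lemma borel_measurable_cutoff [measurable]: "(\<lambda>x::'a::euclidean_space. cutoff R x) \<in> borel_measurable borel"
proof (cases "R = 0")
  case True
  then show ?thesis by (simp add: cutoff_def)
qed (auto intro!: borel_measurable_continuous_onI continuous_intros)

section \<open>The diffusion operator applied to the cutoff\<close>

lemma laplacian_cutoff:
  fixes x :: "real^'n"
  shows "laplacian (\<lambda>x. c * cutoff R x) x = c * (\<Sum>i\<in>UNIV. cutoff_d2 R (axis i 1) (axis i 1) x)"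
proof -
  have 1: "partial_deriv i (\<lambda>x::real^'n. c * cutoff R x) = (\<lambda>x. c * cutoff_d1 R (axis i 1) x)" for i
    unfolding partial_deriv_def
    by (rule ext) (use DERIV_imp_deriv[OF DERIV_cmult[OF DERIV_cutoff_line[of R _ "axis i 1" 0], of c]] in simp)
  have 2: "partial_deriv i (\<lambda>x::real^'n. c * cutoff_d1 R (axis i 1) x) x = c * cutoff_d2 R (axis i 1) (axis i 1) x" for i
    unfolding partial_deriv_def
    using DERIV_imp_deriv[OF DERIV_cmult[OF DERIV_cutoff_d1_line[of R "axis i 1" x "axis i 1" 0], of c]] by simp
  show ?thesis unfolding laplacian_def 1 2 by (simp add: sum_distrib_left)
qed

text \<open>\<open>c\<close> will be the time weight, hence a bound linear in \<open>c\<close> with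
  one constant for all times and radii. The sign clause holds because the second derivatives vanish
  too when \<beta> = 2, and because 0 is the minimum of the cutoff when \<beta> < 2.\<close>

lemma ex_diffusion_cutoff_bound:
  fixes \<beta> :: real
  assumes \<beta>: "0 < \<beta>" "\<beta> \<le> 2"
  shows "\<exists>C>0. \<forall>c R (x::real^'n). 0 \<le> c \<longrightarrow> 0 < R \<longrightarrow>
    diffusion \<beta> (\<lambda>x. c * cutoff R x) x \<le> C * c * R powr (- \<beta>) \<and>
    (cutoff R x = 0 \<longrightarrow> diffusion \<beta> (\<lambda>x. c * cutoff R x) x \<le> 0)"
proof (cases "\<beta> = 2")
  case True
  show ?thesis
  proof (intro exI[of _ "594 * real CARD('n)"] conjI allI impI)
    fix c R :: real and x :: "real^'n"
    assume c: "0 \<le> c" and R: "0 < R"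
    have eq: "diffusion \<beta> (\<lambda>x. c * cutoff R x) x = c * (\<Sum>i\<in>UNIV. - cutoff_d2 R (axis i 1) (axis i 1) x)"
      using True by (simp add: diffusion_def laplacian_cutoff sum_negf)
    have "- cutoff_d2 R (axis i 1) (axis i 1) x \<le> 594 / R\<^sup>2" for i
      using abs_le_D2[OF cutoff_d2_bound[OF R, of "axis i 1" "axis i 1" x]] by (simp add: norm_axis_1)
    then have "(\<Sum>i\<in>UNIV. - cutoff_d2 R (axis i 1) (axis i 1) x) \<le> (\<Sum>i\<in>(UNIV::'n set). 594 / R\<^sup>2)"
      by (rule sum_mono)
    then have "c * (\<Sum>i\<in>UNIV. - cutoff_d2 R (axis i 1) (axis i 1) x) \<le> c * (\<Sum>i\<in>(UNIV::'n set). 594 / R\<^sup>2)"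
      using c by (rule mult_left_mono)
    also have "\<dots> = 594 * real CARD('n) * c * R powr (- \<beta>)"
      using True R by (simp add: powr_minus field_simps)
    finally show "diffusion \<beta> (\<lambda>x. c * cutoff R x) x \<le> 594 * real CARD('n) * c * R powr (- \<beta>)"
      using eq by simp
    assume "cutoff R x = 0"
    then have "cutoff_d2 R (axis i 1) (axis i 1) x = 0" for i
      by (simp add: cutoff_eq_0_iff cutoff_d2_def profile_simps)
    then show "diffusion \<beta> (\<lambda>x. c * cutoff R x) x \<le> 0" using eq by simp
  qed simp
next
  case False
  define \<sigma> where "\<sigma> = \<beta> / 2"
  have \<sigma>: "0 < \<sigma>" "\<sigma> < 1" using \<beta> False by (auto simp: \<sigma>_def)
  obtain C where C: "C > 0" "\<And>(v::real^'n \<Rightarrow> real) x R A B. \<lbrakk>0 < R; 0 \<le> A; v \<in> borel_measurable borel; \<forall>y. 0 \<le> v y \<and> v y \<le> B;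
     \<forall>z. \<bar>2 * v x - v (x + z) - v (x - z)\<bar> \<le> A * min ((norm z / R)\<^sup>2) 1\<rbrakk> \<Longrightarrow>
     frac_laplacian \<sigma> v x \<le> C * A * R powr (-2 * \<sigma>) \<and> (v x = 0 \<longrightarrow> frac_laplacian \<sigma> v x \<le> 0)"
    using ex_frac_laplacian_bound[OF \<sigma>, where 'n='n] by blast
  show ?thesis
  proof (intro exI[of _ "C * 594"] allI impI conjI)
    fix c R :: real and x :: "real^'n"
    assume c: "0 \<le> c" and R: "0 < R"
    define v where "v = (\<lambda>x::real^'n. c * cutoff R x)"
    have D: "diffusion \<beta> v x = frac_laplacian \<sigma> v x" using False by (simp add: diffusion_def \<sigma>_def)
    have "\<bar>2 * v x - v (x + z) - v (x - z)\<bar> \<le> c * 594 * min ((norm z / R)\<^sup>2) 1" for z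
    proof -
      have "2 * v x - v (x + z) - v (x - z) = c * (2 * cutoff R x - cutoff R (x + z) - cutoff R (x - z))"
        by (simp add: v_def algebra_simps)
      then have "\<bar>2 * v x - v (x + z) - v (x - z)\<bar> = c * \<bar>2 * cutoff R x - cutoff R (x + z) - cutoff R (x - z)\<bar>"
        using c by (simp add: abs_mult)
      also have "\<dots> \<le> c * (594 * min ((norm z / R)\<^sup>2) 1)"
        using c by (intro mult_left_mono cutoff_second_difference R)
      finally show ?thesis by simp
    qed
    moreover have "v \<in> borel_measurable borel" unfolding v_def by measurable
    moreover have "\<forall>y. 0 \<le> v y \<and> v y \<le> c"
      unfolding v_def using c by (intro allI conjI mult_nonneg_nonneg mult_left_le cutoff_nonneg cutoff_le_1)
    ultimately have "frac_laplacian \<sigma> v x \<le> C * (c * 594) * R powr (-2 * \<sigma>) \<and> (v x = 0 \<longrightarrow> frac_laplacian \<sigma> v x \<le> 0)"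
      using c by (intro C(2)[OF R]) auto
    then show "diffusion \<beta> (\<lambda>x. c * cutoff R x) x \<le> C * 594 * c * R powr (- \<beta>)"
      and "cutoff R x = 0 \<Longrightarrow> diffusion \<beta> (\<lambda>x. c * cutoff R x) x \<le> 0"
      using D by (auto simp: v_def \<sigma>_def mult_ac)
  qed (use C(1) in simp)
qed

section \<open>The space-time test function\<close>

definition test_fun :: "nat \<Rightarrow> real \<Rightarrow> real \<Rightarrow> real \<Rightarrow> real^'n \<Rightarrow> real" where
  "test_fun l T R t x = max 0 (1 - t / T) ^ l * cutoff R x"

lemma DERIV_time_weight:
  assumes "2 \<le> l" "0 < T"
  shows "((\<lambda>t. max 0 (1 - t / T) ^ l) has_real_derivative - (real l / T * max 0 (1 - t / T) ^ (l - 1))) (at t)"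
proof -
  obtain k where k: "l = Suc (Suc k)" using assms(1) by (metis add_2_eq_Suc le_Suc_ex)
  have "((\<lambda>t. 1 - t / T) has_real_derivative - (1 / T)) (at t)"
    using assms(2) by (auto intro!: derivative_eq_intros)
  from DERIV_chain2[OF DERIV_pos_part_power[of k] this] show ?thesis
    unfolding k by simp
qed

text \<open>The exponent l \<ge> 2 makes the time factor C^1 across t = T; the cubes in
  \<open>profile\<close> make the space factor C^2.\<close>

lemma test_function_test_fun:
  assumes l: "2 \<le> l" and T: "0 < T" and R: "0 < R"
  shows "test_function \<infinity> (test_fun l T R :: real \<Rightarrow> real^'n \<Rightarrow> real)"
  unfolding test_function_def
proof (intro conjI)
  let ?w = "\<lambda>t. max 0 (1 - t / T) ^ l"
  let ?w' = "\<lambda>t. - (real l / T * max 0 (1 - t / T) ^ (l - 1))"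
  have R0: "R \<noteq> 0" using R by simp
  show "continuous_on (halfopen_cyl \<infinity>) (\<lambda>(t, x). test_fun l T R t (x::real^'n))"
    unfolding test_fun_def case_prod_beta using T R0 by (auto intro!: continuous_intros)
  show "\<exists>\<psi>t. continuous_on (halfopen_cyl \<infinity>) (\<lambda>(t, x::real^'n). \<psi>t t x) \<and>
     (\<forall>(t, x) \<in> halfopen_cyl \<infinity>. ((\<lambda>s. test_fun l T R s x) has_real_derivative \<psi>t t x) (at t within {s. 0 \<le> s \<and> ereal s < \<infinity>}))"
  proof (intro exI[of _ "\<lambda>t x. ?w' t * cutoff R x"] conjI)
    show "continuous_on (halfopen_cyl \<infinity>) (\<lambda>(t, x::real^'n). ?w' t * cutoff R x)"
      unfolding case_prod_beta using T R0 by (auto intro!: continuous_intros)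
    show "\<forall>(t, x) \<in> halfopen_cyl \<infinity>. ((\<lambda>s. test_fun l T R s (x::real^'n)) has_real_derivative ?w' t * cutoff R x) (at t within {s. 0 \<le> s \<and> ereal s < \<infinity>})"
      unfolding test_fun_def
      by (intro ballI, clarify, intro DERIV_cmult_right has_field_derivative_at_within[OF DERIV_time_weight[OF l T]])
  qed
  show "\<exists>G H. \<forall>i. continuous_on (halfopen_cyl \<infinity>) (\<lambda>(t, x). G i t x) \<and>
        (\<forall>(t, x) \<in> halfopen_cyl \<infinity>.
           ((\<lambda>h. test_fun l T R t (x + h *\<^sub>R axis i 1 :: real^'n)) has_real_derivative G i t x) (at 0)) \<and>
        (\<forall>j. continuous_on (halfopen_cyl \<infinity>) (\<lambda>(t, x). H i j t x) \<and>
           (\<forall>(t, x) \<in> halfopen_cyl \<infinity>.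
              ((\<lambda>h. G i t (x + h *\<^sub>R axis j 1)) has_real_derivative H i j t x) (at 0)))"
  proof (intro exI[of _ "\<lambda>i t x. ?w t * cutoff_d1 R (axis i 1) x"] exI[of _ "\<lambda>i j t x. ?w t * cutoff_d2 R (axis i 1) (axis j 1) x"] allI conjI)
    fix i j :: 'n
    show "continuous_on (halfopen_cyl \<infinity>) (\<lambda>(t, x). ?w t * cutoff_d1 R (axis i 1) x)"
      "continuous_on (halfopen_cyl \<infinity>) (\<lambda>(t, x). ?w t * cutoff_d2 R (axis i 1) (axis j 1) x)"
      unfolding case_prod_beta using T R0 by (auto intro!: continuous_intros)
    show "\<forall>(t, x) \<in> halfopen_cyl \<infinity>. ((\<lambda>h. test_fun l T R t (x + h *\<^sub>R axis i 1 :: real^'n)) has_real_derivative ?w t * cutoff_d1 R (axis i 1) x) (at 0)"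
      using DERIV_cutoff_line[of R _ _ 0] by (auto simp: test_fun_def intro!: DERIV_cmult)
    show "\<forall>(t, x) \<in> halfopen_cyl \<infinity>. ((\<lambda>h. ?w t * cutoff_d1 R (axis i 1) (x + h *\<^sub>R axis j 1)) has_real_derivative ?w t * cutoff_d2 R (axis i 1) (axis j 1) x) (at 0)"
      using DERIV_cutoff_d1_line[of R _ _ _ 0] by (auto intro!: DERIV_cmult)
  qed
  show "\<exists>C. compact C \<and> C \<subseteq> halfopen_cyl \<infinity> \<and> (\<forall>(t, x) \<in> halfopen_cyl \<infinity> - C. test_fun l T R t (x::real^'n) = 0)"
  proof (intro exI[of _ "{0..T} \<times> cball 0 (2 * R)"] conjI)
    show "\<forall>(t, x) \<in> halfopen_cyl \<infinity> - {0..T} \<times> cball 0 (2 * R). test_fun l T R t (x::real^'n) = 0"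
      using l T by (auto simp: halfopen_cyl_def test_fun_def not_le max_def field_simps intro!: cutoff_eq_0[OF R] split: if_splits)
  qed (auto simp: halfopen_cyl_def intro: compact_Times)
qed

section \<open>The energy inequality\<close>

lemma open_cyl_ereal: "open_cyl (ereal T) = {0<..<T} \<times> UNIV"
  and open_cyl_infinity: "open_cyl \<infinity> = {0<..} \<times> UNIV"
  by (auto simp: open_cyl_def)

text \<open>Tonelli is applied on the Borel product space, whereas \<open>u\<close> is only Lebesgue
  measurable. Local integrability gives measurability on each compact \<open>S n\<close>; the limit
  over the exhaustion has a Borel version.\<close>

lemma locally_integrable_ex_borel:
  fixes f :: "real \<times> (real^'n) \<Rightarrow> real"
  assumes f: "f locally_integrable_on open_cyl \<infinity>"
  shows "\<exists>g \<in> borel_measurable borel. AE z in lborel. 0 < fst z \<longrightarrow> f z = g z"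
proof -
  \<comment> \<open>The lower time endpoint stays positive because compact subsets of the open
    cylinder keep away from t = 0.\<close>
  define S where "S n = {1 / real (Suc n)..real n} \<times> cball (0::real^'n) (real n)" for n
  have "(\<lambda>z. indicator (S n) z * f z) \<in> borel_measurable lebesgue" for n
  proof -
    have "compact (S n)" "S n \<subseteq> open_cyl \<infinity>"
      unfolding S_def open_cyl_infinity by (auto intro!: compact_Times intro: less_le_trans[of 0 "1 / (1 + real n)"])
    then have "f absolutely_integrable_on S n" using f by (auto simp: locally_integrable_on_def)
    then show ?thesis unfolding set_integrable_def by (auto dest!: borel_measurable_integrable)
  qed
  moreover have "(\<lambda>n. indicator (S n) z * f z) \<longlonglongrightarrow> indicator (open_cyl \<infinity>) z * f z" for z
  proof (cases "0 < fst z")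
    case True
    have "filterlim (\<lambda>n. real n) at_top sequentially" by (rule filterlim_real_sequentially)
    then have "eventually (\<lambda>n. max (1 / fst z) (max (fst z) (norm (snd z))) \<le> real n) sequentially"
      by (simp add: filterlim_at_top eventually_conj_iff)
    then have "eventually (\<lambda>n. indicator (S n) z * f z = indicator (open_cyl \<infinity>) z * f z) sequentially"
    proof eventually_elim
      case (elim n)
      then have "1 / real (Suc n) \<le> fst z"
        using True by (auto simp: field_simps)
      then show ?case using elim True by (auto simp: S_def open_cyl_infinity indicator_def mem_Times_iff)
    qed
    then show ?thesis by (rule tendsto_eventually)
  next
    case False
    then have "z \<notin> S n" for n
      using less_le_trans[of 0 "1 / real (Suc n)" "fst z"] by (auto simp: S_def mem_Times_iff)
    then have "indicator (S n) z * f z = indicator (open_cyl \<infinity>) z * f z" for n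
      using False by (simp add: open_cyl_infinity mem_Times_iff)
    then show ?thesis by (simp only: tendsto_const)
  qed
  ultimately have "(\<lambda>z. indicator (open_cyl \<infinity>) z * f z) \<in> borel_measurable lebesgue"
    by (rule borel_measurable_LIMSEQ_real[rotated])
  then obtain g where "g \<in> borel_measurable lborel" "AE z in lborel. indicator (open_cyl \<infinity>) z * f z = g z"
    using completion_ex_borel_measurable_real by blast
  then show ?thesis
    by (intro bexI[of _ g]) (auto simp: open_cyl_infinity indicator_def mem_Times_iff elim!: eventually_mono)
qed

text \<open>Slice statements obtained from Fubini hold for almost every time; this lifts them to
  almost every point of space-time, where they are combined with conditions on (t, x).\<close>

lemma AE_lborel_prod_fst:
  assumes "AE t in lborel. P (t::real)"
  shows "AE z in (lborel :: (real \<times> 'a::euclidean_space) measure). P (fst z)"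
proof -
  obtain N where N: "N \<in> null_sets lborel" "{t. \<not> P t} \<subseteq> N"
    using assms by (auto simp: eventually_ae_filter)
  have "N \<times> UNIV \<in> null_sets (lborel \<Otimes>\<^sub>M (lborel :: 'a measure))"
    using N(1) by (auto simp: null_sets_def lborel.emeasure_pair_measure_Times)
  then have "N \<times> UNIV \<in> null_sets (lborel :: (real \<times> 'a) measure)" by (simp add: lborel_prod)
  then show ?thesis using N(2) by (intro AE_I'[of "N \<times> UNIV"]) auto
qed

section \<open>Lower bound for the nonlinear term\<close>

lemma conv_power_nonneg:
  assumes "\<And>r. 0 < r \<Longrightarrow> 0 < K r"
  shows "0 \<le> conv_power K p u t (x::real^'n)"
proof -
  have "AE y in lebesgue. y \<noteq> x" by (intro AE_completion AE_lborel_singleton)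
  then show ?thesis unfolding conv_power_def
    by (intro integral_nonneg_AE) (auto elim!: eventually_mono intro!: mult_nonneg_nonneg less_imp_le[OF assms])
qed

text \<open>With m = l/p, the p-th power of \<open>damped T m g\<close> carries exactly the time
  factor (1 - t/T)^l of the test function, so Young's inequality can be applied to this product as a
  whole.\<close>

definition damped :: "real \<Rightarrow> real \<Rightarrow> (real \<times> 'a \<Rightarrow> real) \<Rightarrow> real \<times> 'a \<Rightarrow> real" where
  "damped T m g z = indicator {0<..<T} (fst z) * (1 - fst z / T) powr m * g z"

lemma borel_measurable_damped [measurable]:
  fixes g :: "real \<times> 'a::euclidean_space \<Rightarrow> real"
  assumes [measurable]: "g \<in> borel_measurable borel"
  shows "damped T m g \<in> borel_measurable borel"
  unfolding damped_def[abs_def] borel_prod[symmetric] by (measurable; simp add: borel_prod)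

lemma borel_measurable_indicator_snd [measurable]:
  fixes f :: "'a::euclidean_space \<times> 'b::euclidean_space \<Rightarrow> real"
  assumes [measurable]: "A \<in> sets borel" "f \<in> borel_measurable borel"
  shows "(\<lambda>z. indicator A (snd z) * f z) \<in> borel_measurable borel"
  unfolding borel_prod[symmetric] by (measurable; simp add: borel_prod)

text \<open>Only pairs with x in \<open>A\<close> and y in \<open>B\<close> are kept, where the
  kernel is at least \<open>k\<close> and the test function at least its time factor. Nothing then
  depends on x, so by Tonelli the x-integration contributes the measure of \<open>A\<close>, and the
  integral over \<open>B\<close> carries no cutoff.\<close>

lemma conv_power_test_lower:
  fixes u :: "real \<Rightarrow> real^'n \<Rightarrow> real" and g :: "real \<times> (real^'n) \<Rightarrow> real"
  assumes K: "\<And>r. 0 < r \<Longrightarrow> 0 < K r" and p: "0 < p"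
    and fin: "AE (t, x) in lebesgue. (t, x) \<in> open_cyl \<infinity> \<longrightarrow> integrable lebesgue (\<lambda>y. K (norm (x - y)) * \<bar>u t y\<bar> powr p)"
    and g [measurable]: "g \<in> borel_measurable borel" and g0: "\<And>z. 0 \<le> g z"
    and ug: "AE z in lborel. 0 < fst z \<longrightarrow> u (fst z) (snd z) = g z"
    and A [measurable]: "A \<in> sets borel" and B [measurable]: "B \<in> sets borel"
    and k: "0 < k" "\<And>x y. x \<in> A \<Longrightarrow> y \<in> B \<Longrightarrow> x \<noteq> y \<Longrightarrow> k \<le> K (norm (x - y))"
    and Afin: "emeasure lborel A < \<infinity>" "0 < measure lborel A"
    and \<psi>: "\<And>t x. 0 \<le> \<psi> t x" "\<And>t x. x \<in> A \<Longrightarrow> 0 < t \<Longrightarrow> t < T \<Longrightarrow> (1 - t / T) ^ l \<le> \<psi> t x"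
    and int: "(\<lambda>(t, x). conv_power K p u t x * \<psi> t x) absolutely_integrable_on open_cyl (ereal T)"
  defines "e \<equiv> \<lambda>z. indicator B (snd z) * damped T (real l / p) g z powr p"
  shows "integrable lborel e"
    and "k * measure lborel A * integral\<^sup>L lborel e \<le> (LINT (t, x) : open_cyl (ereal T) | lebesgue. conv_power K p u t x * \<psi> t x)"
proof -
  define F where "F t = (\<integral>\<^sup>+y. ennreal (e (t, y)) \<partial>lborel)" for t
  define c where "c z = indicator (open_cyl (ereal T)) z * (conv_power K p u (fst z) (snd z) * \<psi> (fst z) (snd z))" for z
  have [measurable]: "e \<in> borel_measurable borel"
    unfolding e_def by measurable
  have e0: "0 \<le> e z" for z unfolding e_def by simp
  have e_out: "e (t, y) = 0" if "\<not> (0 < t \<and> t < T)" for t y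
    using that by (auto simp: e_def damped_def indicator_def)
  have e_eq: "e (t, y) = indicator B y * g (t, y) powr p * (1 - t / T) ^ l" if "0 < t" "t < T" for t y
    using that p g0[of "(t, y)"]
    by (simp add: e_def damped_def powr_mult powr_powr powr_realpow field_simps)
  have c0: "0 \<le> c z" for z
    unfolding c_def using conv_power_nonneg[of K p u] K \<psi>(1) by simp
  have c_int: "integrable lebesgue c"
    using int unfolding set_integrable_def c_def by (simp add: case_prod_beta)
  have AE_ug: "AE z in (lborel :: (real \<times> (real^'n)) measure). AE y in lborel. 0 < fst z \<longrightarrow> u (fst z) y = g (fst z, y)"
  proof (rule AE_lborel_prod_fst)
    have "AE z in lborel \<Otimes>\<^sub>M lborel. 0 < fst z \<longrightarrow> u (fst z) (snd z) = g z"
      using ug unfolding lborel_prod .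
    from lborel_pair.AE_pair[OF this] show "AE t in lborel. AE y in lborel. 0 < t \<longrightarrow> u t y = g (t, y)"
      by simp
  qed
  have "AE z in lebesgue. ennreal (k * indicator A (snd z)) * F (fst z) \<le> ennreal (c z)"
    using fin AE_completion[OF AE_ug]
  proof eventually_elim
    case (elim z)
    obtain t x where z: "z = (t, x)" by (cases z)
    show ?case
    proof (cases "x \<in> A \<and> 0 < t \<and> t < T")
      case True
      have inti: "integrable lebesgue (\<lambda>y. K (norm (x - y)) * \<bar>u t y\<bar> powr p)"
        using elim(1) True by (simp add: z open_cyl_infinity)
      have AE1: "AE y in lebesgue. y \<noteq> x \<and> u t y = g (t, y)"
        using AE_completion[OF elim(2)] AE_completion[OF AE_lborel_singleton[of x]] True by (auto simp: z)
      have "ennreal k * F t = (\<integral>\<^sup>+y. ennreal (k * e (t, y)) \<partial>lborel)"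
        unfolding F_def using k(1) by (subst nn_integral_cmult[symmetric]) (auto simp: ennreal_mult' e0)
      also have "\<dots> = (\<integral>\<^sup>+y. ennreal (k * e (t, y)) \<partial>lebesgue)" by (simp add: nn_integral_completion)
      also have "\<dots> \<le> (\<integral>\<^sup>+y. ennreal (K (norm (x - y)) * \<bar>u t y\<bar> powr p * \<psi> t x) \<partial>lebesgue)"
      proof (rule nn_integral_mono_AE, use AE1 in eventually_elim)
        fix y assume y: "y \<noteq> x \<and> u t y = g (t, y)"
        have "k * e (t, y) \<le> K (norm (x - y)) * \<bar>u t y\<bar> powr p * \<psi> t x"
        proof (cases "y \<in> B")
          case yB: True
          have "k * e (t, y) = k * g (t, y) powr p * (1 - t / T) ^ l"
            using True yB by (simp add: e_eq)
          also have "\<dots> \<le> K (norm (x - y)) * g (t, y) powr p * \<psi> t x"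
            using True yB y k \<psi>(2)[of x t] by (intro mult_mono) (auto intro!: less_imp_le[OF K] mult_nonneg_nonneg)
          finally show ?thesis using y g0 by simp
        next
          case False
          then have "k * e (t, y) = 0" using True by (simp add: e_eq)
          moreover have "0 \<le> K (norm (x - y)) * \<bar>u t y\<bar> powr p * \<psi> t x"
            using y by (intro mult_nonneg_nonneg \<psi>(1) less_imp_le[OF K]) auto
          ultimately show ?thesis by linarith
        qed
        then show "ennreal (k * e (t, y)) \<le> ennreal (K (norm (x - y)) * \<bar>u t y\<bar> powr p * \<psi> t x)"
          by (rule ennreal_leI)
      qed
      \<comment> \<open>\<open>inti\<close> excludes the default value 0 of a divergent Bochner
        integral, so \<open>conv_power\<close> really dominates the nonnegative integral.\<close>
      also have "\<dots> = ennreal (LINT y|lebesgue. K (norm (x - y)) * \<bar>u t y\<bar> powr p * \<psi> t x)"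
      proof (rule nn_integral_eq_integral)
        show "AE y in lebesgue. 0 \<le> K (norm (x - y)) * \<bar>u t y\<bar> powr p * \<psi> t x"
          using AE1 by eventually_elim (auto intro!: mult_nonneg_nonneg less_imp_le[OF K] \<psi>(1))
      qed (use inti in simp)
      also have "\<dots> = ennreal (c z)"
        using True by (simp add: c_def z conv_power_def open_cyl_ereal)
      finally show ?thesis using True by (simp add: z)
    next
      case False
      then have "ennreal (k * indicator A (snd z)) * F (fst z) = 0"
        by (auto simp: z F_def e_out indicator_def)
      then show ?thesis by (simp only: zero_le)
    qed
  qed
  then have "(\<integral>\<^sup>+z. ennreal (k * indicator A (snd z)) * F (fst z) \<partial>lebesgue) \<le> (\<integral>\<^sup>+z. ennreal (c z) \<partial>lebesgue)"
    by (rule nn_integral_mono_AE)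
  also have "\<dots> = ennreal (integral\<^sup>L lebesgue c)"
    using c_int c0 by (intro nn_integral_eq_integral) auto
  also have "(\<integral>\<^sup>+z. ennreal (k * indicator A (snd z)) * F (fst z) \<partial>lebesgue) = ennreal (k * measure lborel A) * (\<integral>\<^sup>+z. ennreal (e z) \<partial>lborel)"
  proof -
    have [measurable]: "F \<in> borel_measurable borel"
    proof -
      have "(\<lambda>z. ennreal (e z)) \<in> borel_measurable (borel \<Otimes>\<^sub>M borel)"
        unfolding borel_prod by measurable
      then show ?thesis unfolding F_def by measurable
    qed
    have "(\<integral>\<^sup>+z. ennreal (k * indicator A (snd z)) * F (fst z) \<partial>lebesgue)
      = (\<integral>\<^sup>+z. ennreal (k * indicator A (snd z)) * F (fst z) \<partial>(lborel \<Otimes>\<^sub>M lborel))"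
      by (simp add: nn_integral_completion lborel_prod)
    also have "\<dots> = (\<integral>\<^sup>+t. \<integral>\<^sup>+x. ennreal (k * indicator A x) * F t \<partial>lborel \<partial>lborel)"
      by (subst lborel.nn_integral_fst[symmetric]) auto
    also have "\<dots> = (\<integral>\<^sup>+t. ennreal (k * measure lborel A) * F t \<partial>lborel)"
    proof -
      have "(\<integral>\<^sup>+x. ennreal (k * indicator A x) * a \<partial>lborel) = ennreal (k * measure lborel A) * a" for a
        using k(1) Afin by (simp add: nn_integral_multc ennreal_mult' nn_integral_cmult ennreal_indicator emeasure_eq_ennreal_measure)
      then show ?thesis by simp
    qed
    also have "\<dots> = ennreal (k * measure lborel A) * (\<integral>\<^sup>+t. F t \<partial>lborel)"
      by (rule nn_integral_cmult) simp
    also have "(\<integral>\<^sup>+t. F t \<partial>lborel) = (\<integral>\<^sup>+z. ennreal (e z) \<partial>lborel)"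
      unfolding F_def by (subst lborel.nn_integral_fst) (simp_all add: lborel_prod)
    finally show ?thesis .
  qed
  finally have le: "ennreal (k * measure lborel A) * (\<integral>\<^sup>+z. ennreal (e z) \<partial>lborel) \<le> ennreal (integral\<^sup>L lebesgue c)" .
  \<comment> \<open>A positive multiple of the integral of \<open>e\<close> lies below a finite
    number; integrability of \<open>e\<close> is thus a conclusion, not an assumption.\<close>
  have kA: "0 < k * measure lborel A" using k Afin by simp
  have "(\<integral>\<^sup>+z. ennreal (e z) \<partial>lborel) < \<infinity>"
  proof (rule ccontr)
    assume "\<not> (\<integral>\<^sup>+z. ennreal (e z) \<partial>lborel) < \<infinity>"
    then have "(\<integral>\<^sup>+z. ennreal (e z) \<partial>lborel) = \<infinity>" by (simp add: less_top[symmetric])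
    then show False using le kA by (simp add: ennreal_mult_top ennreal_eq_0_iff top_unique)
  qed
  then show ei: "integrable lborel e" using e0 by (intro integrableI_nonneg) auto
  have "(\<integral>\<^sup>+z. ennreal (e z) \<partial>lborel) = ennreal (integral\<^sup>L lborel e)"
    using ei e0 by (intro nn_integral_eq_integral) auto
  then have "ennreal (k * measure lborel A * integral\<^sup>L lborel e) \<le> ennreal (integral\<^sup>L lebesgue c)"
    using le kA e0 by (simp add: ennreal_mult'[symmetric] integral_nonneg_AE)
  then have "k * measure lborel A * integral\<^sup>L lborel e \<le> integral\<^sup>L lebesgue c"
    by (simp add: ennreal_le_iff c0 integral_nonneg_AE)
  then show "k * measure lborel A * integral\<^sup>L lborel e \<le> (LINT (t, x) : open_cyl (ereal T) | lebesgue. conv_power K p u t x * \<psi> t x)"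
    unfolding set_lebesgue_integral_def c_def by (simp add: case_prod_beta)
qed

section \<open>Young's inequality and the upper bound for the linear terms\<close>

lemma le_young:
  fixes a \<theta> p :: real
  assumes "0 \<le> a" "0 < \<theta>" "1 < p"
  shows "a \<le> \<theta> * a powr p + \<theta> powr (- 1 / (p - 1))"
\<comment> \<open>Either \<open>a\<close> is large, and one factor of \<open>a\<close> is paid for
  by \<theta> a^(p-1) \<ge> 1, or it is below the threshold \<theta>^(-1/(p-1)). This gives Young's
  inequality with non-optimal constants.\<close>
proof (cases "\<theta> * a powr (p - 1) \<ge> 1")
  case True
  then have "a * 1 \<le> a * (\<theta> * a powr (p - 1))" using assms by (intro mult_left_mono) auto
  also have "\<dots> = \<theta> * a powr p"
    using assms by (cases "a = 0") (auto simp: powr_diff)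
  finally show ?thesis by (simp add: add_increasing2)
next
  case False
  show ?thesis
  proof (cases "a = 0")
    case False
    then have a: "0 < a" using assms by simp
    have "a powr (p - 1) < inverse \<theta>" using \<open>\<not> _ \<le> _\<close> assms by (simp add: field_simps)
    then have "(a powr (p - 1)) powr (1 / (p - 1)) \<le> inverse \<theta> powr (1 / (p - 1))"
      using assms by (intro powr_mono2) auto
    then have "a \<le> \<theta> powr (- 1 / (p - 1))"
      using assms a by (simp add: powr_powr powr_minus inverse_powr)
    moreover have "0 \<le> \<theta> * a powr p" using assms by simp
    ultimately show ?thesis by linarith
  qed simp
qed

text \<open>The pointwise inequality integrated over (0,T) x A. The choice \<theta> = 1 already
  gives integrability; in the estimate \<theta> stays free, since it will depend on the radius and
  on the region.\<close>

lemma damped_young: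
  fixes g :: "real \<times> 'a::euclidean_space \<Rightarrow> real"
  assumes [measurable]: "g \<in> borel_measurable borel" "A \<in> sets borel" and g0: "\<And>z. 0 \<le> g z"
    and A: "emeasure lborel A < \<infinity>" and T: "0 < T" and p: "1 < p"
    and int: "integrable lborel (\<lambda>z. indicator A (snd z) * damped T m g z powr p)"
  shows "integrable lborel (\<lambda>z. indicator A (snd z) * damped T m g z)"
    and "0 < \<theta> \<Longrightarrow> (LINT z|lborel. indicator A (snd z) * damped T m g z) \<le>
       \<theta> * (LINT z|lborel. indicator A (snd z) * damped T m g z powr p) + \<theta> powr (- 1 / (p - 1)) * T * measure lborel A"
proof -
  define I where "I z = (indicator ({0<..<T} \<times> A) z :: real)" for z :: "real \<times> 'a"
  have [measurable]: "{0<..<T} \<times> A \<in> sets borel" by (simp add: borel_prod[symmetric])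
  have em: "emeasure lborel ({0<..<T} \<times> A) = ennreal (T * measure lborel A)"
    unfolding lborel_prod[symmetric] using A T
    by (simp add: lborel.emeasure_pair_measure_Times emeasure_eq_ennreal_measure ennreal_mult')
  have I_int: "integrable lborel I" unfolding I_def using em by simp
  have I_eq: "integral\<^sup>L lborel I = T * measure lborel A"
    unfolding I_def using em T by (simp add: measure_def)
  define d where "d z = indicator A (snd z) * damped T m g z" for z
  have [measurable]: "d \<in> borel_measurable borel"
    unfolding d_def by measurable
  have d0: "0 \<le> d z" for z unfolding d_def damped_def using g0 by simp
  have le: "d z \<le> \<theta> * (indicator A (snd z) * damped T m g z powr p) + \<theta> powr (- 1 / (p - 1)) * I z"
    if "0 < \<theta>" for z \<theta>
    using le_young[OF d0 that p, of z] p
    by (cases "snd z \<in> A \<and> 0 < fst z \<and> fst z < T") (auto simp: d_def I_def damped_def indicator_def mem_Times_iff)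
  show d_int: "integrable lborel (\<lambda>z. indicator A (snd z) * damped T m g z)"
    unfolding d_def[symmetric]
    by (rule Bochner_Integration.integrable_bound[of _ "\<lambda>z. 1 * (indicator A (snd z) * damped T m g z powr p) + 1 powr (- 1 / (p - 1)) * I z"])
      (use int I_int le[of 1] d0 in \<open>auto intro!: AE_I2 order_trans[OF _ abs_ge_self]\<close>)
  assume \<theta>: "0 < \<theta>"
  have "integral\<^sup>L lborel d \<le> (LINT z|lborel. \<theta> * (indicator A (snd z) * damped T m g z powr p) + \<theta> powr (- 1 / (p - 1)) * I z)"
    using d_int int I_int le[OF \<theta>] by (intro integral_mono) (auto simp: d_def[abs_def])
  also have "\<dots> = \<theta> * (LINT z|lborel. indicator A (snd z) * damped T m g z powr p) + \<theta> powr (- 1 / (p - 1)) * T * measure lborel A"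
    using int I_int I_eq by simp
  finally show "(LINT z|lborel. indicator A (snd z) * damped T m g z) \<le>
       \<theta> * (LINT z|lborel. indicator A (snd z) * damped T m g z powr p) + \<theta> powr (- 1 / (p - 1)) * T * measure lborel A"
    unfolding d_def .
qed


text \<open>l \<ge> p/(p-1) is the condition l - 1 \<ge> l/p in another form; adding 2 also
  guarantees l \<ge> 2, as differentiability in time demands.\<close>

definition time_exponent :: "real \<Rightarrow> nat" where
  "time_exponent p = nat \<lceil>p / (p - 1)\<rceil> + 2"

lemma time_exponent:
  assumes "1 < p"
  shows "2 \<le> time_exponent p" "real (time_exponent p) / p \<le> real (time_exponent p - 1)"
proof -
  let ?l = "real (time_exponent p)"
  have "p / (p - 1) \<le> real (nat \<lceil>p / (p - 1)\<rceil>)" by linarith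
  then have "p / (p - 1) \<le> ?l" by (simp add: time_exponent_def)
  then have "p \<le> ?l * (p - 1)" using assms by (simp add: field_simps)
  then have "?l / p \<le> ?l - 1" using assms by (simp add: field_simps)
  then show "?l / p \<le> real (time_exponent p - 1)" by (simp add: time_exponent_def)
qed (simp add: time_exponent_def)

text \<open>With T = R^\<beta> both linear terms scale like R^(-\<beta>). In the ball of radius 2R
  their time factors s^l and s^(l-1) are at most s^(l/p), because 0 < s < 1; outside, the time
  derivative vanishes and the diffusion term has the favourable sign.\<close>

lemma test_fun_rhs_upper:
  fixes u :: "real \<Rightarrow> real^'n \<Rightarrow> real" and g :: "real \<times> (real^'n) \<Rightarrow> real"
  assumes p: "1 < p" and R: "0 < R" and C: "0 < C"
    and D: "\<And>c x::real^'n. 0 \<le> c \<Longrightarrow> diffusion \<beta> (\<lambda>x. c * cutoff R x) x \<le> C * c * R powr (- \<beta>)"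
      "\<And>c x::real^'n. 0 \<le> c \<Longrightarrow> cutoff R x = 0 \<Longrightarrow> diffusion \<beta> (\<lambda>x. c * cutoff R x) x \<le> 0"
    and g [measurable]: "g \<in> borel_measurable borel" and g0: "\<And>z. 0 \<le> g z"
    and ug: "AE z in lborel. 0 < fst z \<longrightarrow> u (fst z) (snd z) = g z"
  defines "T \<equiv> R powr \<beta>" and "l \<equiv> time_exponent p"
  defines "\<psi> \<equiv> test_fun l T R" and "d \<equiv> \<lambda>z. indicator (cball 0 (2 * R)) (snd z) * damped T (real l / p) g z"
  assumes int: "(\<lambda>(t, x). u t x * diffusion \<beta> (\<psi> t) x) absolutely_integrable_on open_cyl (ereal T)"
    "(\<lambda>(t, x). u t x * deriv (\<lambda>s. \<psi> s x) t) absolutely_integrable_on open_cyl (ereal T)"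
    and d_int: "integrable lborel d"
  shows "(LINT (t, x) : open_cyl (ereal T) | lebesgue. u t x * diffusion \<beta> (\<psi> t) x) -
      (LINT (t, x) : open_cyl (ereal T) | lebesgue. u t x * deriv (\<lambda>s. \<psi> s x) t)
      \<le> (C + real l) * R powr (- \<beta>) * integral\<^sup>L lborel d"
proof -
  let ?S = "open_cyl (ereal T) :: (real \<times> (real^'n)) set"
  define a where "a z = indicator ?S z * (u (fst z) (snd z) * diffusion \<beta> (\<psi> (fst z)) (snd z))" for z
  define b where "b z = indicator ?S z * (u (fst z) (snd z) * deriv (\<lambda>s. \<psi> s (snd z)) (fst z))" for z
  have T: "0 < T" using R by (simp add: T_def)
  note l = time_exponent[OF p, folded l_def]
  have ai: "integrable lebesgue a" and bi: "integrable lebesgue b"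
    using int unfolding set_integrable_def a_def b_def by (simp_all add: case_prod_beta)
  have [measurable]: "d \<in> borel_measurable borel"
    unfolding d_def by (intro borel_measurable_indicator_snd borel_measurable_damped g) simp
  have di: "integrable lebesgue d" using d_int by (intro integrable_completion[THEN iffD2]) auto
  have "(LINT z|lebesgue. a z - b z) \<le> (LINT z|lebesgue. (C + real l) * R powr (- \<beta>) * d z)"
  proof (rule integral_mono_AE)
    show "AE z in lebesgue. a z - b z \<le> (C + real l) * R powr (- \<beta>) * d z"
      using AE_completion[OF ug]
    proof eventually_elim
      case (elim z)
      obtain t x where z: "z = (t, x)" by (cases z)
      show ?case
      proof (cases "0 < t \<and> t < T")
        case False
        then show ?thesis
          by (auto simp: a_def b_def z open_cyl_ereal d_def damped_def indicator_def)
      next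
        case True
        define s where "s = 1 - t / T"
        have s: "0 < s" "s < 1" using True T by (auto simp: s_def)
        have s_max: "max 0 (1 - t / T) = s" using s by (simp add: s_def)
        have "((\<lambda>s. \<psi> s x) has_real_derivative - (real l / T * s ^ (l - 1)) * cutoff R x) (at t)"
          unfolding \<psi>_def test_fun_def s_max[symmetric]
          by (intro DERIV_cmult_right DERIV_time_weight l T)
        then have der: "deriv (\<lambda>s. \<psi> s x) t = - (real l / T * s ^ (l - 1)) * cutoff R x"
          by (rule DERIV_imp_deriv)
        have \<psi>t: "\<psi> t = (\<lambda>x. s ^ l * cutoff R x)"
          unfolding \<psi>_def test_fun_def s_max ..
        have eq: "a z - b z = g (t, x) * (diffusion \<beta> (\<psi> t) x + real l / T * s ^ (l - 1) * cutoff R x)"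
          using elim True by (simp add: a_def b_def z open_cyl_ereal der algebra_simps)
        show ?thesis
        proof (cases "norm x \<le> 2 * R")
          case True
          have sl: "s ^ l \<le> s powr (real l / p)" "s ^ (l - 1) \<le> s powr (real l / p)"
          proof -
            have "s powr real (l - 1) \<le> s powr (real l / p)"
              using s l by (intro powr_mono') auto
            then show 1: "s ^ (l - 1) \<le> s powr (real l / p)" using s by (simp add: powr_realpow)
            have "s ^ l \<le> s ^ (l - 1)" using s by (intro power_decreasing) auto
            then show "s ^ l \<le> s powr (real l / p)" using 1 by linarith
          qed
          have Tinv: "1 / T = R powr (- \<beta>)" by (simp add: T_def powr_minus_divide)
          have "diffusion \<beta> (\<psi> t) x \<le> C * s ^ l * R powr (- \<beta>)"
            unfolding \<psi>t using s by (intro D) auto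
          also have "\<dots> \<le> C * s powr (real l / p) * R powr (- \<beta>)"
            using sl C by (intro mult_right_mono mult_left_mono) auto
          finally have 1: "diffusion \<beta> (\<psi> t) x \<le> C * s powr (real l / p) * R powr (- \<beta>)" .
          have "real l / T * s ^ (l - 1) * cutoff R x \<le> real l / T * s powr (real l / p) * 1"
            using sl s T by (intro mult_mono mult_left_mono cutoff_le_1 cutoff_nonneg) auto
          also have "\<dots> = real l * s powr (real l / p) * R powr (- \<beta>)"
            using Tinv by (metis (no_types, opaque_lifting) mult.assoc mult.commute mult_1 times_divide_eq_left)
          finally have 2: "real l / T * s ^ (l - 1) * cutoff R x \<le> real l * s powr (real l / p) * R powr (- \<beta>)" .
          have "a z - b z \<le> g (t, x) * (C * s powr (real l / p) * R powr (- \<beta>) + real l * s powr (real l / p) * R powr (- \<beta>))"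
            unfolding eq by (intro mult_left_mono add_mono 1 2 g0)
          also have "\<dots> = (C + real l) * R powr (- \<beta>) * d z"
            using True \<open>0 < t \<and> t < T\<close> by (simp add: d_def z damped_def s_def[symmetric] algebra_simps)
          finally show ?thesis .
        next
          case False
          have c0: "cutoff R x = 0" using False by (intro cutoff_eq_0 R) auto
          then have "diffusion \<beta> (\<psi> t) x \<le> 0" unfolding \<psi>t using s by (intro D) auto
          then have "a z - b z \<le> 0" unfolding eq c0 using g0 by (simp add: mult_nonneg_nonpos)
          also have "0 \<le> (C + real l) * R powr (- \<beta>) * d z"
            using C g0 by (simp add: d_def damped_def)
          finally show ?thesis .
        qed
      qed
    qed
  qed (use ai bi di in auto)
  then have "integral\<^sup>L lebesgue a - integral\<^sup>L lebesgue b \<le> (C + real l) * R powr (- \<beta>) * integral\<^sup>L lborel d"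
    using ai bi by (simp add: integral_completion)
  then show ?thesis
    unfolding set_lebesgue_integral_def a_def b_def by (simp add: case_prod_beta)
qed

section \<open>Energies of a fixed nonnegative solution\<close>

lemma inf_kernel_antimono:
  fixes K :: "real \<Rightarrow> real"
  assumes K: "\<And>r. 0 < r \<Longrightarrow> 0 < K r" and inf: "(INF r\<in>{0<..<R}. K r) = K R" and r: "0 < r" "r \<le> R"
  shows "K R \<le> K r"
proof (cases "r = R")
  case False
  \<comment> \<open>A real infimum is a lower bound only for sets bounded below, which positivity of
    \<open>K\<close> ensures. The endpoint r = R lies outside the open interval and is treated
    separately.\<close>
  have "bdd_below (K ` {0<..<R})" using K by (intro bdd_belowI2[of _ 0]) (auto intro: less_imp_le)
  then show ?thesis unfolding inf[symmetric] using False r by (intro cINF_lower) auto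
qed simp

text \<open>One solution together with a Borel representative \<open>g\<close> that is nonnegative
  everywhere, not just almost everywhere. Existence of such a \<open>g\<close> is shown at the
  end.\<close>

locale nonneg_solution =
  fixes K :: "real \<Rightarrow> real" and \<beta> p R0 \<omega> :: real and u0 :: "real^'n \<Rightarrow> real"
    and u :: "real \<Rightarrow> real^'n \<Rightarrow> real" and g :: "real \<times> (real^'n) \<Rightarrow> real"
  assumes \<beta>: "0 < \<beta>" "\<beta> \<le> 2" and p: "1 < p"
    and K_pos: "\<And>r. 0 < r \<Longrightarrow> 0 < K r"
    and \<omega>_eq: "\<omega> = unit_ball_vol (real CARD('n))"
    and R0: "1 < R0" and K_inf: "\<And>R. R0 < R \<Longrightarrow> (INF r\<in>{0<..<R}. K r) = K R"
    and sol: "global_weak_solution K \<beta> p u0 u"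
    and g_borel [measurable]: "g \<in> borel_measurable borel" and g_nonneg: "\<And>z. 0 \<le> g z"
    and u_eq_g: "AE z in lborel. 0 < fst z \<longrightarrow> u (fst z) (snd z) = g z"
begin

definition weighted :: "real \<Rightarrow> real \<times> (real^'n) \<Rightarrow> real" where
  "weighted R = damped (R powr \<beta>) (real (time_exponent p) / p) g"

text \<open>The weighted integral of \<open>u^p\<close> over (0, R^\<beta>) x A: the exponent l/p
  inside \<open>weighted\<close> becomes l after raising to the power p.\<close>

definition energy :: "real \<Rightarrow> (real^'n) set \<Rightarrow> real" where
  "energy R A = (LINT z|lborel. indicator A (snd z) * weighted R z powr p)"

definition mass :: "real \<Rightarrow> (real^'n) set \<Rightarrow> real" where
  "mass R A = (LINT z|lborel. indicator A (snd z) * weighted R z)"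

lemma weighted_borel [measurable]: "weighted R \<in> borel_measurable borel"
  unfolding weighted_def by measurable

lemma K_antimono: "R0 < R \<Longrightarrow> 0 < r \<Longrightarrow> r \<le> R \<Longrightarrow> K R \<le> K r"
  using inf_kernel_antimono[OF K_pos K_inf] by blast

text \<open>The average of two lower bounds for the source: x in the ball of radius R with y in that
  of radius 2R, at distance at most 3R; and both points in the ball of radius R/2, at distance at
  most R. Averaging explains the factors \<omega>/2.\<close>

lemma energy_inequality:
  "\<exists>C>0. \<forall>R>R0. integrable lborel (\<lambda>z. indicator (cball 0 (2 * R)) (snd z) * weighted R z powr p) \<and>
    integrable lebesgue (\<lambda>x. u0 x * cutoff R x) \<and>
    \<omega> / 2 * R ^ CARD('n) * (K (3 * R) * energy R (cball 0 (2 * R))) +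
    \<omega> / 2 * (R / 2) ^ CARD('n) * (K R * energy R (cball 0 (R / 2))) +
    (LINT x|lebesgue. u0 x * cutoff R x) \<le> C * R powr (- \<beta>) * mass R (cball 0 (2 * R))"
proof -
  obtain C where C: "C > 0" "\<And>c R (x::real^'n). 0 \<le> c \<Longrightarrow> 0 < R \<Longrightarrow> diffusion \<beta> (\<lambda>x. c * cutoff R x) x \<le> C * c * R powr (- \<beta>)"
    "\<And>c R (x::real^'n). 0 \<le> c \<Longrightarrow> 0 < R \<Longrightarrow> cutoff R x = 0 \<Longrightarrow> diffusion \<beta> (\<lambda>x. c * cutoff R x) x \<le> 0"
    using ex_diffusion_cutoff_bound[OF \<beta>, where 'n='n] by blast
  define l where "l = time_exponent p"
  note l = time_exponent[OF p, folded l_def]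
  show ?thesis
  proof (intro exI[of _ "C + real l"] conjI[of "C + real l > 0"] allI impI)
    fix R assume R: "R0 < R"
    have R1: "0 < R" using R R0 by linarith
    define T where "T = R powr \<beta>"
    define \<psi> where "\<psi> = (test_fun l T R :: real \<Rightarrow> real^'n \<Rightarrow> real)"
    have T: "0 < T" using R1 by (simp add: T_def)
    have "test_function \<infinity> \<psi>" unfolding \<psi>_def by (rule test_function_test_fun[OF l(1) T R1])
    \<comment> \<open>The weak formulation is used at \<tau> = T, where it asks the test function to
      vanish; l > 0 provides this.\<close>
    moreover have "\<forall>x. \<psi> T x = 0" using T l by (simp add: \<psi>_def test_fun_def)
    moreover have "\<psi> 0 x = cutoff R x" for x by (simp add: \<psi>_def test_fun_def)
    ultimately have w: "(\<lambda>(t, x). conv_power K p u t x * \<psi> t x) absolutely_integrable_on open_cyl (ereal T)"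
        "integrable lebesgue (\<lambda>x. u0 x * cutoff R x)"
        "(\<lambda>(t, x). u t x * diffusion \<beta> (\<psi> t) x) absolutely_integrable_on open_cyl (ereal T)"
        "(\<lambda>(t, x). u t x * deriv (\<lambda>s. \<psi> s x) t) absolutely_integrable_on open_cyl (ereal T)"
        "(LINT (t, x) : open_cyl (ereal T) | lebesgue. conv_power K p u t x * \<psi> t x) + (LINT x | lebesgue. u0 x * cutoff R x) =
        (LINT (t, x) : open_cyl (ereal T) | lebesgue. u t x * diffusion \<beta> (\<psi> t) x) -
        (LINT (t, x) : open_cyl (ereal T) | lebesgue. u t x * deriv (\<lambda>s. \<psi> s x) t)"
      using sol T unfolding weak_solution_def by (auto dest!: spec[of _ T] spec[of _ \<psi>])
    have fin: "AE (t, x) in lebesgue. (t, x) \<in> open_cyl \<infinity> \<longrightarrow> integrable lebesgue (\<lambda>y. K (norm (x - y)) * \<bar>u t y\<bar> powr p)"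
      using sol unfolding weak_solution_def by blast
    have p0: "0 < p" using p by simp
    have low: "integrable lborel (\<lambda>z. indicator (cball 0 s) (snd z) * weighted R z powr p) \<and>
       K (r + s) * (\<omega> * r ^ CARD('n)) * energy R (cball 0 s) \<le> (LINT (t, x) : open_cyl (ereal T) | lebesgue. conv_power K p u t x * \<psi> t x)"
      if rs: "0 < r" "r \<le> R" "0 < s" "R0 < r + s" for r s
    proof -
      have m: "measure lborel (cball (0::real^'n) r) = \<omega> * r ^ CARD('n)"
        using rs by (simp add: content_cball \<omega>_eq)
      have k: "K (r + s) \<le> K (norm (x - y))" if "x \<in> cball 0 r" "y \<in> cball 0 s" "x \<noteq> y" for x y :: "real^'n"
        using that norm_triangle_ineq4[of x y] rs by (intro K_antimono) auto
      have m0: "0 < \<omega> * r ^ CARD('n)" using rs by (simp add: \<omega>_eq)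
      note * = conv_power_test_lower[OF K_pos p0 fin g_borel g_nonneg u_eq_g, where A="cball 0 r" and B="cball 0 s" and k="K (r + s)"
          and \<psi>=\<psi> and T=T and l=l]
      have \<psi>1: "0 \<le> \<psi> t x" for t x unfolding \<psi>_def test_fun_def by (intro mult_nonneg_nonneg cutoff_nonneg) simp
      have \<psi>2: "(1 - t / T) ^ l \<le> \<psi> t x" if "x \<in> cball 0 r" "0 < t" "t < T" for t x
        using that rs R1 by (simp add: \<psi>_def test_fun_def cutoff_eq_1)
      show ?thesis
        unfolding energy_def weighted_def T_def[symmetric] l_def[symmetric] m[symmetric]
        by (intro conjI *) (use rs k \<psi>1 \<psi>2 w(1) m m0 in \<open>auto intro!: K_pos simp: emeasure_cball\<close>)
    qed
    have 1: "integrable lborel (\<lambda>z. indicator (cball 0 (2 * R)) (snd z) * weighted R z powr p)"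
      and e1: "K (3 * R) * (\<omega> * R ^ CARD('n)) * energy R (cball 0 (2 * R)) \<le> (LINT (t, x) : open_cyl (ereal T) | lebesgue. conv_power K p u t x * \<psi> t x)"
      using low[of R "2 * R"] R R1 by auto
    have e2: "K R * (\<omega> * (R / 2) ^ CARD('n)) * energy R (cball 0 (R / 2)) \<le> (LINT (t, x) : open_cyl (ereal T) | lebesgue. conv_power K p u t x * \<psi> t x)"
      using low[of "R / 2" "R / 2"] R R1 by auto
    have d_int: "integrable lborel (\<lambda>z. indicator (cball 0 (2 * R)) (snd z) * weighted R z)"
      unfolding weighted_def
      by (rule damped_young(1)[OF g_borel _ g_nonneg _ _ p 1[unfolded weighted_def]]) (use R1 in \<open>auto simp: emeasure_cball\<close>)
    have rhs: "(LINT (t, x) : open_cyl (ereal T) | lebesgue. u t x * diffusion \<beta> (\<psi> t) x) -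
        (LINT (t, x) : open_cyl (ereal T) | lebesgue. u t x * deriv (\<lambda>s. \<psi> s x) t)
        \<le> (C + real l) * R powr (- \<beta>) * mass R (cball 0 (2 * R))"
      unfolding mass_def weighted_def \<psi>_def T_def l_def
      by (rule test_fun_rhs_upper[OF p R1 C(1) C(2)[OF _ R1] C(3)[OF _ R1] g_borel g_nonneg u_eq_g])
        (use w(3,4) d_int in \<open>simp_all add: weighted_def \<psi>_def T_def l_def\<close>)
    have "\<omega> / 2 * R ^ CARD('n) * (K (3 * R) * energy R (cball 0 (2 * R))) +
      \<omega> / 2 * (R / 2) ^ CARD('n) * (K R * energy R (cball 0 (R / 2))) +
      (LINT x|lebesgue. u0 x * cutoff R x) \<le> (C + real l) * R powr (- \<beta>) * mass R (cball 0 (2 * R))"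
    proof -
      have halves: "\<omega> / 2 * R ^ CARD('n) * (K (3 * R) * a) = K (3 * R) * (\<omega> * R ^ CARD('n)) * a / 2"
        "\<omega> / 2 * (R / 2) ^ CARD('n) * (K R * a) = K R * (\<omega> * (R / 2) ^ CARD('n)) * a / 2" for a
        by simp_all
      show ?thesis unfolding halves using rhs e1 e2 w(5) by linarith
    qed
    with 1 w(2) show "integrable lborel (\<lambda>z. indicator (cball 0 (2 * R)) (snd z) * weighted R z powr p) \<and>
      integrable lebesgue (\<lambda>x. u0 x * cutoff R x) \<and>
      \<omega> / 2 * R ^ CARD('n) * (K (3 * R) * energy R (cball 0 (2 * R))) +
      \<omega> / 2 * (R / 2) ^ CARD('n) * (K R * energy R (cball 0 (R / 2))) +
      (LINT x|lebesgue. u0 x * cutoff R x) \<le> (C + real l) * R powr (- \<beta>) * mass R (cball 0 (2 * R))"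
      by blast
  qed (use C(1) in simp)
qed

end

section \<open>Critical growth of the kernel\<close>

text \<open>The cutoff is radial and nonincreasing, so its superlevel sets are balls. Their radii
  are at least R since it equals 1 there, and at most 2R by its support; closedness of
  \<open>S\<close> makes the supremum attained, hence a closed ball.\<close>

lemma cutoff_level_set:
  fixes R s :: real
  assumes R: "0 < R" and s: "0 < s" "s \<le> 1"
  shows "\<exists>r. R \<le> r \<and> r \<le> 2 * R \<and> (\<forall>x::'a::real_inner. s \<le> cutoff R x \<longleftrightarrow> norm x \<le> r)"
proof -
  define S where "S = {t. 0 \<le> t \<and> s \<le> profile ((t / R)\<^sup>2)}"
  define r where "r = Sup S"
  have RS: "R \<in> S" using R s by (simp add: S_def profile_simps)
  have ub: "t \<le> 2 * R" if "t \<in> S" for t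
  proof (rule ccontr)
    assume "\<not> t \<le> 2 * R"
    then have "2 \<le> t / R" using R by (simp add: field_simps)
    then have "2\<^sup>2 \<le> (t / R)\<^sup>2" by (intro power_mono) auto
    then have "profile ((t / R)\<^sup>2) = 0" by (simp add: profile_eq_0_iff)
    then show False using that s by (simp add: S_def)
  qed
  have "closed S"
    unfolding S_def using R by (intro closed_Collect_conj closed_Collect_le continuous_intros) auto
  then have rS: "r \<in> S" unfolding r_def using RS ub by (intro closed_contains_Sup) (auto intro!: bdd_aboveI)
  have le_r: "t \<le> r" if "t \<in> S" for t
    unfolding r_def using that ub by (intro cSup_upper) (auto intro!: bdd_aboveI)
  have down: "t \<in> S" if "0 \<le> t" "t \<le> r" for t
  proof -
    have "(t / R)\<^sup>2 \<le> (r / R)\<^sup>2" using that R by (intro power_mono divide_right_mono) auto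
    then have "profile ((r / R)\<^sup>2) \<le> profile ((t / R)\<^sup>2)" by (rule profile_antimono)
    then show ?thesis using rS that by (auto simp: S_def)
  qed
  have "s \<le> cutoff R x \<longleftrightarrow> norm x \<le> r" for x :: 'a
    using le_r[of "norm x"] down[of "norm x"] by (auto simp: S_def cutoff_def)
  then show ?thesis using le_r[OF RS] ub[OF rS] by blast
qed

text \<open>The integral against the cutoff is an average over \<open>s \<in> {0<..1}\<close> of integrals over its superlevel
  sets, which are balls.\<close>

lemma integral_cutoff_lower:
  fixes u0 :: "'a::euclidean_space \<Rightarrow> real"
  assumes R: "0 < R" and u0: "u0 locally_integrable_on UNIV"
    and lower: "\<And>r. R \<le> r \<Longrightarrow> r \<le> 2 * R \<Longrightarrow> - M \<le> (LINT x : cball 0 r | lebesgue. u0 x)"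
  shows "- M \<le> (LINT x | lebesgue. u0 x * cutoff R x)"
proof -
  have "set_integrable lebesgue (cball 0 (2 * R)) u0"
    using u0 by (simp add: locally_integrable_on_def)
  then have int: "integrable lebesgue (\<lambda>x. indicator (cball 0 (2 * R)) x * u0 x)"
    by (simp add: set_integrable_def)
  obtain f where f [measurable]: "f \<in> borel_measurable borel"
    and fu: "AE x in lborel. indicator (cball 0 (2 * R)) x * u0 x = f x"
    using completion_ex_borel_measurable_real[OF borel_measurable_integrable[OF int]] by auto
  have fu': "AE x in lebesgue. indicator (cball 0 (2 * R)) x * u0 x = f x" by (rule AE_completion[OF fu])
  have "integrable lebesgue f"
    using int fu' by (subst integrable_cong_AE[where g = "\<lambda>x. indicator (cball 0 (2 * R)) x * u0 x"])
      (auto elim!: eventually_mono intro: measurable_completion)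
  then have fi: "integrable lborel f" by (simp add: integrable_completion)
  \<comment> \<open>Layer-cake integrand: integrating in s over (0, cutoff R x] gives f x * cutoff R
    x, integrating in x gives the integral of f over a superlevel set.\<close>
  define H where "H s x = indicator {0<..1} s * (indicator {x. s \<le> cutoff R x} x * f x)" for s :: real and x
  have H_meas: "case_prod H \<in> borel_measurable (lborel \<Otimes>\<^sub>M lborel)"
    unfolding H_def by measurable
  \<comment> \<open>Fubini integrability is checked with s as the inner variable, where each slice
    is an interval of length \<open>cutoff R x\<close>.\<close>
  have swap_int: "integrable (lborel \<Otimes>\<^sub>M lborel) (\<lambda>(x, s). H s x)"
  proof (rule lborel_pair.Fubini_integrable)
    show "(\<lambda>(x, s). H s x) \<in> borel_measurable (lborel \<Otimes>\<^sub>M lborel)"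
      unfolding H_def by measurable
    have *: "H s x = indicator ({0<..1} \<inter> {..cutoff R x}) s * f x" for s x
      by (auto simp: H_def indicator_def)
    have "{0<..1} \<inter> {..cutoff R x} = {0<..cutoff R x}" for x :: 'a
      using cutoff_le_1[of R x] by auto
    then have **: "H s x = indicator {0<..cutoff R x} s * f x" for s x using * by simp
    show "AE x in lborel. integrable lborel (\<lambda>s. case (x, s) of (x, s) \<Rightarrow> H s x)"
      by (auto simp: ** cutoff_nonneg)
    show "integrable lborel (\<lambda>x. LINT s|lborel. norm (case (x, s) of (x, s) \<Rightarrow> H s x))"
    proof -
      have "(LINT s|lborel. norm (case (x, s) of (x, s) \<Rightarrow> H s x)) = cutoff R x * \<bar>f x\<bar>" for x
        by (simp add: ** abs_mult cutoff_nonneg)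
      moreover have "integrable lborel (\<lambda>x. cutoff R x * \<bar>f x\<bar>)"
        by (rule Bochner_Integration.integrable_bound[OF fi])
          (auto intro!: AE_I2 mult_left_le_one_le simp: abs_mult cutoff_nonneg cutoff_le_1)
      ultimately show ?thesis by simp
    qed
  qed
  have H_int: "integrable (lborel \<Otimes>\<^sub>M lborel) (case_prod H)"
    using lborel_pair.integrable_product_swap[OF swap_int] by (simp add: case_prod_beta)
  have inner: "(LINT s|lborel. H s x) = f x * cutoff R x" for x
  proof -
    have "H s x = indicator {0<..cutoff R x} s * f x" for s
      using cutoff_le_1[of R x] by (auto simp: H_def indicator_def)
    then show ?thesis by (simp add: cutoff_nonneg)
  qed
  \<comment> \<open>For s in (0,1] the slice is an integral of \<open>u0\<close> over a ball of
    radius between R and 2R, to which \<open>lower\<close> applies; for other s both sides are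
    0.\<close>
  have outer: "- M * indicator {0<..1} s \<le> (LINT x|lborel. H s x)" for s
  proof (cases "0 < s \<and> s \<le> 1")
    case True
    then obtain r where r: "R \<le> r" "r \<le> 2 * R" "\<And>x::'a. s \<le> cutoff R x \<longleftrightarrow> norm x \<le> r"
      using cutoff_level_set[OF R, of s, where 'a='a] by blast
    have "(LINT x : cball 0 r | lebesgue. u0 x) = (LINT x|lebesgue. indicator (cball 0 r) x * (indicator (cball 0 (2 * R)) x * u0 x))"
      unfolding set_lebesgue_integral_def using r by (intro Bochner_Integration.integral_cong) (auto simp: indicator_def)
    also have "\<dots> = (LINT x|lebesgue. H s x)"
    proof (rule integral_cong_AE)
      show "AE x in lebesgue. indicator (cball 0 r) x * (indicator (cball 0 (2 * R)) x * u0 x) = H s x"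
        using fu' by eventually_elim (use True r in \<open>auto simp: H_def indicator_def\<close>)
      have "cball (0::'a) r \<in> sets lebesgue" by simp
      then show "(\<lambda>x. indicator (cball 0 r) x * (indicator (cball 0 (2 * R)) x * u0 x)) \<in> borel_measurable lebesgue"
        using borel_measurable_integrable[OF int] by (rule borel_measurable_times[OF borel_measurable_indicator])
      have "H s \<in> borel_measurable lborel" unfolding H_def[abs_def] by measurable
      then show "H s \<in> borel_measurable lebesgue" by (rule measurable_completion)
    qed
    also have "\<dots> = (LINT x|lborel. H s x)"
    proof -
      have "H s \<in> borel_measurable lborel" unfolding H_def[abs_def] by measurable
      then show ?thesis by (rule integral_completion)
    qed
    finally show ?thesis using lower[OF r(1,2)] True by simp
  qed (auto simp: H_def indicator_def)
  have "- M = (LINT s|lborel. - M * indicator {0<..1::real} s)" by simp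
  also have "\<dots> \<le> (LINT s|lborel. LINT x|lborel. H s x)"
    using lborel_pair.integrable_fst'[OF H_int] outer by (intro integral_mono) auto
  also have "\<dots> = (LINT x|lborel. LINT s|lborel. H s x)"
    using lborel_pair.Fubini_integral[OF H_int] by simp
  also have "\<dots> = (LINT x|lborel. f x * cutoff R x)" by (simp add: inner)
  also have "\<dots> = (LINT x|lebesgue. f x * cutoff R x)" by (simp add: integral_completion)
  also have "\<dots> = (LINT x|lebesgue. indicator (cball 0 (2 * R)) x * u0 x * cutoff R x)"
  proof (rule integral_cong_AE)
    show "AE x in lebesgue. f x * cutoff R x = indicator (cball 0 (2 * R)) x * u0 x * cutoff R x"
      using fu' by eventually_elim auto
    show "(\<lambda>x. f x * cutoff R x) \<in> borel_measurable lebesgue"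
      by (rule measurable_completion) measurable
    have "cutoff R \<in> borel_measurable (lebesgue :: 'a measure)" by (rule measurable_completion) measurable
    then show "(\<lambda>x. indicator (cball 0 (2 * R)) x * u0 x * cutoff R x) \<in> borel_measurable lebesgue"
      using borel_measurable_integrable[OF int] by (rule borel_measurable_times[rotated])
  qed
  also have "\<dots> = (LINT x|lebesgue. u0 x * cutoff R x)"
    by (intro Bochner_Integration.integral_cong) (auto simp: indicator_def intro!: cutoff_eq_0[OF R])
  finally show ?thesis .
qed

context nonneg_solution
begin

section \<open>The energy estimate at good radii\<close>

lemma energy_nonneg: "0 \<le> energy R A"
  unfolding energy_def by (intro integral_nonneg_AE) auto

lemma \<omega>_pos: "0 < \<omega>" by (simp add: \<omega>_eq)

lemma energy_subset_integrable:
  assumes "integrable lborel (\<lambda>z. indicator B (snd z) * weighted R z powr p)" "A \<subseteq> B" and [measurable]: "A \<in> sets borel"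
  shows "integrable lborel (\<lambda>z. indicator A (snd z) * weighted R z powr p)"
proof (rule Bochner_Integration.integrable_bound[OF assms(1)])
  show "(\<lambda>z. indicator A (snd z) * weighted R z powr p) \<in> borel_measurable lborel" by measurable
qed (use assms(2) in \<open>auto intro!: AE_I2 simp: indicator_def\<close>)

lemma energy_mono:
  assumes "integrable lborel (\<lambda>z. indicator B (snd z) * weighted R z powr p)" "A \<subseteq> B" "A \<in> sets borel"
  shows "energy R A \<le> energy R B"
  unfolding energy_def using assms energy_subset_integrable[OF assms]
  by (intro integral_mono) (auto simp: indicator_def)

lemma mass_le:
  assumes "0 < \<theta>" "0 < R" "integrable lborel (\<lambda>z. indicator A (snd z) * weighted R z powr p)" "A \<in> sets borel"
    and A: "A \<subseteq> cball 0 s" "0 \<le> s"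
  shows "mass R A \<le> \<theta> * energy R A + \<theta> powr (- 1 / (p - 1)) * R powr \<beta> * (\<omega> * s ^ CARD('n))"
    and "integrable lborel (\<lambda>z. indicator A (snd z) * weighted R z)"
proof -
  have fin: "emeasure lborel A \<le> emeasure lborel (cball (0::real^'n) s)" using A by (intro emeasure_mono) auto
  also have "\<dots> = ennreal (\<omega> * s ^ CARD('n))" using A(2) by (simp add: emeasure_cball \<omega>_eq)
  finally have le: "emeasure lborel A \<le> ennreal (\<omega> * s ^ CARD('n))" .
  then have Afin: "emeasure lborel A < \<infinity>" by (auto simp: order_le_less_trans)
  have m: "measure lborel A \<le> \<omega> * s ^ CARD('n)"
    unfolding measure_def using le \<omega>_pos A(2) by (intro enn2real_leI) auto
  note * = damped_young[OF g_borel assms(4) g_nonneg Afin _ p assms(3)[unfolded weighted_def], folded weighted_def]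
  have R\<beta>: "0 < R powr \<beta>" using assms(2) by simp
  have "mass R A \<le> \<theta> * energy R A + \<theta> powr (- 1 / (p - 1)) * R powr \<beta> * measure lborel A"
    using *(2)[OF R\<beta> assms(1)] by (simp add: mass_def energy_def)
  also have "\<dots> \<le> \<theta> * energy R A + \<theta> powr (- 1 / (p - 1)) * R powr \<beta> * (\<omega> * s ^ CARD('n))"
    using m by (intro add_left_mono mult_left_mono) auto
  finally show "mass R A \<le> \<theta> * energy R A + \<theta> powr (- 1 / (p - 1)) * R powr \<beta> * (\<omega> * s ^ CARD('n))" .
  show "integrable lborel (\<lambda>z. indicator A (snd z) * weighted R z)" using *(1)[OF R\<beta>] .
qed

text \<open>The choice \<open>\<theta> = e R\<^sup>n\<^sup>+\<^sup>\<beta> k\<close> with \<open>k = R powr (-(n + \<beta>) / p)\<close> makes both Young terms proportional to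
  \<open>R\<^sup>n k\<close>.\<close>

lemma critical_scaling:
  assumes "0 < R" "0 < e"
  defines "k \<equiv> R powr (- (real CARD('n) + \<beta>) / p)"
  defines "\<theta> \<equiv> e * (R powr (real CARD('n) + \<beta>) * k)"
  shows "R powr (- \<beta>) * \<theta> = e * R ^ CARD('n) * k"
    and "R powr (- \<beta>) * (\<theta> powr (- 1 / (p - 1)) * R powr \<beta>) = e powr (- 1 / (p - 1)) * k"
proof -
  show "R powr (- \<beta>) * \<theta> = e * R ^ CARD('n) * k"
    using assms(1) by (simp add: \<theta>_def powr_add powr_minus powr_realpow)
  \<comment> \<open>This is (1 - 1/p) / (p - 1) = 1/p: the exponent of \<open>k\<close> is the one
    reproduced by the Young remainder.\<close>
  have "((real CARD('n) + \<beta>) + (- (real CARD('n) + \<beta>) / p)) * (- 1 / (p - 1)) = - (real CARD('n) + \<beta>) / p"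
    using p by (simp add: field_simps)
  then have "(R powr (real CARD('n) + \<beta>) * k) powr (- 1 / (p - 1)) = k"
    unfolding k_def powr_add[symmetric] powr_powr by simp
  then have "\<theta> powr (- 1 / (p - 1)) = e powr (- 1 / (p - 1)) * k"
    unfolding \<theta>_def using assms by (subst powr_mult) auto
  then show "R powr (- \<beta>) * (\<theta> powr (- 1 / (p - 1)) * R powr \<beta>) = e powr (- 1 / (p - 1)) * k"
    using assms(1) by (simp add: powr_minus)
qed

text \<open>The constant is fixed before \<epsilon>, \<kappa> and e, so these can later be tuned
  freely. The terms come, in order, from the data, the Young remainder on the inner ball, the energy
  outside it, and the Young remainder there; the inner energy is absorbed.\<close>

lemma energy_estimate:
  assumes c: "0 < c" and freq: "\<exists>\<^sub>F R in at_top. c < K R * R powr ((real CARD('n) + \<beta>) / p)"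
    and u0: "u0 locally_integrable_on UNIV"
    and lower: "\<And>\<epsilon>. 0 < \<epsilon> \<Longrightarrow> \<forall>\<^sub>F R in at_top. - \<epsilon> * R ^ CARD('n) * K R \<le> (LINT x : cball 0 R | lebesgue. u0 x)"
  shows "\<exists>C>0. \<forall>\<epsilon>>0. \<forall>\<kappa>>0. \<forall>e>0. \<kappa> \<le> 2 \<longrightarrow> (\<exists>\<^sub>F R in at_top.
    energy R (cball 0 (R / 2)) \<le> C * (\<epsilon> + \<kappa> ^ CARD('n) + e * energy R (cball 0 (2 * R) - cball 0 (\<kappa> * R)) + e powr (- 1 / (p - 1))))"
proof -
  let ?n = "CARD('n)"
  let ?q = "- 1 / (p - 1)"
  obtain C where C: "C > 0" "\<And>R. R0 < R \<Longrightarrow> integrable lborel (\<lambda>z. indicator (cball 0 (2 * R)) (snd z) * weighted R z powr p)"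
    "\<And>R. R0 < R \<Longrightarrow> \<omega> / 2 * R ^ ?n * (K (3 * R) * energy R (cball 0 (2 * R))) +
    \<omega> / 2 * (R / 2) ^ ?n * (K R * energy R (cball 0 (R / 2))) +
    (LINT x|lebesgue. u0 x * cutoff R x) \<le> C * R powr (- \<beta>) * mass R (cball 0 (2 * R))"
    using energy_inequality by blast
  \<comment> \<open>Growth at radius 3R reads \<open>k \<le> c1 * K (3 * R)\<close>; the power of 3
    converts (3R) into R.\<close>
  define c1 where "c1 = 3 powr ((real ?n + \<beta>) / p) / c"
  have c1: "0 < c1" using c by (simp add: c1_def)
  \<comment> \<open>Chosen so that the Young term on the inner ball is exactly the \<omega>/2
    multiple available for absorption.\<close>
  define e1 where "e1 = \<omega> / (2 * C * c1)"
  have e1: "0 < e1" "C * c1 * e1 = \<omega> / 2" using \<omega>_pos C(1) c1 by (simp_all add: e1_def field_simps)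
  define a where "a = e1 powr ?q * \<omega>"
  have a: "0 \<le> a" using \<omega>_pos by (simp add: a_def)
  define D where "D = (2 ^ Suc ?n / \<omega>) * (2 ^ ?n + C * c1 * (a + 1 + \<omega> * 2 ^ ?n))"
  have D: "0 < D" using \<omega>_pos C(1) c1 a
    by (auto simp: D_def intro!: mult_pos_pos divide_pos_pos add_pos_nonneg mult_nonneg_nonneg add_nonneg_nonneg)
  show ?thesis
  proof (intro exI[of _ D] conjI D allI impI)
    fix \<epsilon> \<kappa> e :: real
    assume \<epsilon>: "0 < \<epsilon>" and \<kappa>: "0 < \<kappa>" "\<kappa> \<le> 2" and e: "0 < e"
    obtain \<rho> where \<rho>: "\<And>r. \<rho> \<le> r \<Longrightarrow> - \<epsilon> * r ^ ?n * K r \<le> (LINT x : cball 0 r | lebesgue. u0 x)"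
      using lower[OF \<epsilon>] by (auto simp: eventually_at_top_linorder)
    \<comment> \<open>Absorption involves \<open>K (3 * R)\<close>, so the good radii are rescaled
      by 3.\<close>
    have "\<exists>\<^sub>F R in at_top. c < K (3 * R) * (3 * R) powr ((real ?n + \<beta>) / p)"
      unfolding frequently_def
    proof
      assume "\<forall>\<^sub>F R in at_top. \<not> c < K (3 * R) * (3 * R) powr ((real ?n + \<beta>) / p)"
      then have "\<forall>\<^sub>F R in at_top. \<not> c < K (3 * (R / 3)) * (3 * (R / 3)) powr ((real ?n + \<beta>) / p)"
        by (rule eventually_compose_filterlim) real_asymp
      then show False using freq by (simp add: frequently_def)
    qed
    moreover have "\<forall>\<^sub>F R in at_top. max (R0 + 1) \<rho> \<le> R" by (rule eventually_ge_at_top)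
    ultimately have "\<exists>\<^sub>F R in at_top. max (R0 + 1) \<rho> \<le> R \<and> c < K (3 * R) * (3 * R) powr ((real ?n + \<beta>) / p)"
      by (rule frequently_eventually_conj)
    then show "\<exists>\<^sub>F R in at_top. energy R (cball 0 (R / 2)) \<le>
       D * (\<epsilon> + \<kappa> ^ ?n + e * energy R (cball 0 (2 * R) - cball 0 (\<kappa> * R)) + e powr ?q)"
    proof (rule frequently_elim1)
      fix R assume R': "max (R0 + 1) \<rho> \<le> R \<and> c < K (3 * R) * (3 * R) powr ((real ?n + \<beta>) / p)"
      then have R: "R0 < R" "\<rho> \<le> R" "0 < R" using R0 by auto
      define k where "k = R powr (- (real ?n + \<beta>) / p)"
      define X where "X = energy R (cball 0 (2 * R))"
      define Y where "Y = energy R (cball 0 (R / 2))"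
      define Z where "Z = energy R (cball 0 (2 * R) - cball 0 (\<kappa> * R))"
      have X: "0 \<le> X" and Z: "0 \<le> Z" unfolding X_def Z_def by (rule energy_nonneg)+
      have k: "0 < k" using R by (simp add: k_def)
      have K3: "0 < K (3 * R)" "K (3 * R) \<le> K R" "0 < K R"
        using R R0 by (auto intro!: K_pos K_antimono)
      have kK: "k \<le> c1 * K (3 * R)"
      proof -
        have "c * k < K (3 * R) * (3 * R) powr ((real ?n + \<beta>) / p) * k"
          using R' k by (intro mult_strict_right_mono) auto
        also have "\<dots> = K (3 * R) * 3 powr ((real ?n + \<beta>) / p)"
        proof -
          have "R powr ((real ?n + \<beta>) / p) * k = 1"
            unfolding k_def powr_add[symmetric] minus_divide_left[symmetric] using R by simp
          then show ?thesis using R by (simp add: powr_mult mult.assoc)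
        qed
        finally show ?thesis using c by (simp add: c1_def field_simps)
      qed
      \<comment> \<open>Two Young parameters: \<theta>1 has the fixed \<open>e1\<close>, whose
        remainder is harmless because the inner ball has volume proportional to \<kappa>^n;
        \<theta>2 has the free \<open>e\<close>, whose energy term will be harmless because little
        energy lies outside.\<close>
      define \<theta>1 where "\<theta>1 = e1 * (R powr (real ?n + \<beta>) * k)"
      define \<theta>2 where "\<theta>2 = e * (R powr (real ?n + \<beta>) * k)"
      have \<theta>: "0 < \<theta>1" "0 < \<theta>2" using e1 e k R by (simp_all add: \<theta>1_def \<theta>2_def)
      let ?A = "cball (0::real^'n) (\<kappa> * R)" and ?B = "cball (0::real^'n) (2 * R) - cball 0 (\<kappa> * R)"
      have sub: "?A \<subseteq> cball 0 (2 * R)" using \<kappa> R by (intro subset_cball) auto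
      have intA: "integrable lborel (\<lambda>z. indicator ?A (snd z) * weighted R z powr p)"
        and intB: "integrable lborel (\<lambda>z. indicator ?B (snd z) * weighted R z powr p)"
        using sub by (auto intro!: energy_subset_integrable[OF C(2)[OF R(1)]])
      have mA: "mass R ?A \<le> \<theta>1 * X + \<theta>1 powr ?q * R powr \<beta> * (\<omega> * (\<kappa> * R) ^ ?n)"
      proof -
        have "mass R ?A \<le> \<theta>1 * energy R ?A + \<theta>1 powr ?q * R powr \<beta> * (\<omega> * (\<kappa> * R) ^ ?n)"
          using \<theta> R \<kappa> intA by (intro mass_le) auto
        also have "\<theta>1 * energy R ?A \<le> \<theta>1 * X"
          using \<theta> energy_mono[OF C(2)[OF R(1)] sub] by (simp add: X_def)
        finally show ?thesis by simp
      qed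
      have mB: "mass R ?B \<le> \<theta>2 * Z + \<theta>2 powr ?q * R powr \<beta> * (\<omega> * (2 * R) ^ ?n)"
        unfolding Z_def using \<theta> R intB by (intro mass_le) auto
      have "mass R (cball 0 (2 * R)) = (LINT z|lborel. indicator ?A (snd z) * weighted R z + indicator ?B (snd z) * weighted R z)"
        unfolding mass_def using sub by (intro Bochner_Integration.integral_cong) (auto simp: indicator_def)
      also have "\<dots> = mass R ?A + mass R ?B"
        unfolding mass_def using intA intB R \<kappa>
        by (intro Bochner_Integration.integral_add mass_le(2)[OF \<theta>(1) _ _ _ _ _, of _ _ "2 * R"]) (use sub in auto)
      also have "\<dots> \<le> (\<theta>1 * X + \<theta>1 powr ?q * R powr \<beta> * (\<omega> * (\<kappa> * R) ^ ?n)) + (\<theta>2 * Z + \<theta>2 powr ?q * R powr \<beta> * (\<omega> * (2 * R) ^ ?n))"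
        by (intro add_mono mA mB)
      finally have "R powr (- \<beta>) * mass R (cball 0 (2 * R)) \<le> R powr (- \<beta>) *
          ((\<theta>1 * X + \<theta>1 powr ?q * R powr \<beta> * (\<omega> * (\<kappa> * R) ^ ?n)) + (\<theta>2 * Z + \<theta>2 powr ?q * R powr \<beta> * (\<omega> * (2 * R) ^ ?n)))"
        by (intro mult_left_mono) auto
      also have "\<dots> = (R powr (- \<beta>) * \<theta>1) * X + (R powr (- \<beta>) * (\<theta>1 powr ?q * R powr \<beta>)) * (\<omega> * (\<kappa> * R) ^ ?n) +
          ((R powr (- \<beta>) * \<theta>2) * Z + (R powr (- \<beta>) * (\<theta>2 powr ?q * R powr \<beta>)) * (\<omega> * (2 * R) ^ ?n))"
        by (simp only: distrib_left mult.assoc)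
      also have "\<dots> = R ^ ?n * k * (e1 * X + a * \<kappa> ^ ?n + (e * Z + e powr ?q * \<omega> * 2 ^ ?n))"
        unfolding \<theta>1_def \<theta>2_def k_def critical_scaling[OF R(3) e1(1)] critical_scaling[OF R(3) e] a_def
        by (simp add: algebra_simps power_mult_distrib)
      finally have "C * R powr (- \<beta>) * mass R (cball 0 (2 * R)) \<le> C * (R ^ ?n * k * (e1 * X + a * \<kappa> ^ ?n + (e * Z + e powr ?q * \<omega> * 2 ^ ?n)))"
        using C(1) by (simp add: mult.assoc)
      also have "\<dots> \<le> C * (R ^ ?n * (c1 * K (3 * R)) * (e1 * X + a * \<kappa> ^ ?n + (e * Z + e powr ?q * \<omega> * 2 ^ ?n)))"
        using C(1) R kK X Z e1 e a \<kappa> \<omega>_pos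
        by (intro mult_left_mono mult_right_mono add_nonneg_nonneg mult_nonneg_nonneg) auto
      also have "\<dots> = (C * c1 * e1) * (R ^ ?n * (K (3 * R) * X)) + K (3 * R) * (C * c1 * R ^ ?n * (a * \<kappa> ^ ?n + (e * Z + e powr ?q * \<omega> * 2 ^ ?n)))"
        by (simp add: algebra_simps)
      \<comment> \<open>The energy term keeps \<open>K (3 * R)\<close> and will cancel; the
        remainders pass to the larger \<open>K R\<close>, the factor they must share with the data
        term and with \<open>Y\<close>.\<close>
      also have "\<dots> \<le> \<omega> / 2 * (R ^ ?n * (K (3 * R) * X)) + K R * (C * c1 * R ^ ?n * (a * \<kappa> ^ ?n + (e * Z + e powr ?q * \<omega> * 2 ^ ?n)))"
        unfolding e1(2) using C(1) R c1 X Z e1 e a \<kappa> \<omega>_pos K3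
        by (intro add_left_mono mult_right_mono add_nonneg_nonneg mult_nonneg_nonneg) auto
      finally have up: "C * R powr (- \<beta>) * mass R (cball 0 (2 * R)) \<le>
          \<omega> / 2 * R ^ ?n * (K (3 * R) * X) + K R * (C * c1 * R ^ ?n * (a * \<kappa> ^ ?n + (e * Z + e powr ?q * \<omega> * 2 ^ ?n)))"
        by (simp add: mult.assoc)
      \<comment> \<open>On radii r between R and 2R the hypothesis is weakened to one bound using
        r^n \<le> (2R)^n and \<open>K r \<le> K R\<close>.\<close>
      have "- (\<epsilon> * (2 ^ ?n * R ^ ?n) * K R) \<le> (LINT x|lebesgue. u0 x * cutoff R x)"
      proof (rule integral_cutoff_lower[OF R(3) u0])
        fix r assume r: "R \<le> r" "r \<le> 2 * R"
        have "r ^ ?n \<le> (2 * R) ^ ?n" using r R by (intro power_mono) auto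
        moreover have "K r \<le> K R" using r R by (intro K_antimono) auto
        moreover have "0 < K r" using r R by (intro K_pos) auto
        ultimately have "\<epsilon> * r ^ ?n * K r \<le> \<epsilon> * (2 * R) ^ ?n * K R"
          using \<epsilon> r R by (intro mult_mono mult_left_mono) auto
        then show "- (\<epsilon> * (2 ^ ?n * R ^ ?n) * K R) \<le> (LINT x : cball 0 r | lebesgue. u0 x)"
          using \<rho>[of r] r R by (simp add: power_mult_distrib)
      qed
      then have "\<omega> / 2 * (R / 2) ^ ?n * (K R * Y) \<le> K R * (C * c1 * R ^ ?n * (a * \<kappa> ^ ?n + (e * Z + e powr ?q * \<omega> * 2 ^ ?n)))
          + \<epsilon> * (2 ^ ?n * R ^ ?n) * K R"
        using C(3)[OF R(1)] up unfolding X_def[symmetric] Y_def[symmetric] by linarith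
      then have "(K R * R ^ ?n) * (\<omega> / 2 ^ Suc ?n * Y) \<le> (K R * R ^ ?n) * (C * c1 * (a * \<kappa> ^ ?n + (e * Z + e powr ?q * \<omega> * 2 ^ ?n)) + \<epsilon> * 2 ^ ?n)"
        by (simp add: power_divide algebra_simps)
      then have "\<omega> / 2 ^ Suc ?n * Y \<le> C * c1 * (a * \<kappa> ^ ?n + (e * Z + e powr ?q * \<omega> * 2 ^ ?n)) + \<epsilon> * 2 ^ ?n"
        using K3 R by (subst (asm) mult_le_cancel_left_pos) auto
      also have "\<dots> \<le> C * c1 * ((a + 1 + \<omega> * 2 ^ ?n) * (\<epsilon> + \<kappa> ^ ?n + e * Z + e powr ?q)) + (\<epsilon> + \<kappa> ^ ?n + e * Z + e powr ?q) * 2 ^ ?n"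
      proof (intro add_mono mult_left_mono mult_right_mono)
        define b1 b2 b3 w where "b1 = \<kappa> ^ ?n" and "b2 = e * Z" and "b3 = e powr ?q" and "w = \<omega> * 2 ^ ?n"
        have b: "0 \<le> b1" "0 \<le> b2" "0 \<le> b3" "0 \<le> w" using \<kappa> e Z \<omega>_pos by (auto simp: b1_def b2_def b3_def w_def)
        have "a * b1 + (b2 + b3 * w) \<le> (a + 1 + w) * (\<epsilon> + b1 + b2 + b3)"
        proof -
          have "(a + 1 + w) * (\<epsilon> + b1 + b2 + b3) = (a * b1 + (b2 + b3 * w)) + ((a + 1 + w) * \<epsilon> + (1 + w) * b1 + (a + w) * b2 + (a + 1) * b3)"
            by (simp add: algebra_simps)
          moreover have "0 \<le> (a + 1 + w) * \<epsilon> + (1 + w) * b1 + (a + w) * b2 + (a + 1) * b3"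
            using a b \<epsilon> by (intro add_nonneg_nonneg mult_nonneg_nonneg) auto
          ultimately show ?thesis by linarith
        qed
        then show "a * \<kappa> ^ ?n + (e * Z + e powr ?q * \<omega> * 2 ^ ?n) \<le> (a + 1 + \<omega> * 2 ^ ?n) * (\<epsilon> + \<kappa> ^ ?n + e * Z + e powr ?q)"
          by (simp add: b1_def b2_def b3_def w_def mult.assoc)
        show "\<epsilon> \<le> \<epsilon> + \<kappa> ^ ?n + e * Z + e powr ?q" using b by (simp add: b1_def b2_def b3_def)
      qed (use C(1) c1 in auto)
      also have "\<dots> = \<omega> / 2 ^ Suc ?n * (D * (\<epsilon> + \<kappa> ^ ?n + e * Z + e powr ?q))"
        using \<omega>_pos by (simp add: D_def field_simps)
      finally show "Y \<le> D * (\<epsilon> + \<kappa> ^ ?n + e * Z + e powr ?q)"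
        using \<omega>_pos by (subst (asm) mult_le_cancel_left_pos) auto
    qed
  qed
qed

end

context nonneg_solution
begin

section \<open>Integrability of u^p and vanishing of the solution\<close>

definition u_power :: "real \<times> (real^'n) \<Rightarrow> real" where
  "u_power z = indicator {0<..} (fst z) * g z powr p"

lemma borel_measurable_u_power [measurable]: "u_power \<in> borel_measurable borel"
  unfolding u_power_def[abs_def] borel_prod[symmetric] by (measurable; simp add: borel_prod)

lemma u_power_nonneg: "0 \<le> u_power z"
  unfolding u_power_def by simp

lemma weighted_powr: "weighted R z powr p = indicator {0<..<R powr \<beta>} (fst z) * (1 - fst z / R powr \<beta>) ^ time_exponent p * g z powr p"
proof (cases "0 < fst z \<and> fst z < R powr \<beta>")
  case True
  then have "0 < R powr \<beta>" by linarith
  then have "0 < 1 - fst z / R powr \<beta>" using True by simp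
  then show ?thesis
    using True p g_nonneg[of z] by (simp add: weighted_def damped_def powr_mult powr_powr powr_realpow)
qed (auto simp: weighted_def damped_def indicator_def)

lemma weighted_powr_le_u_power: "weighted R z powr p \<le> u_power z"
proof (cases "0 < fst z \<and> fst z < R powr \<beta>")
  case True
  then have "0 < R powr \<beta>" by linarith
  then have "0 \<le> 1 - fst z / R powr \<beta>" "1 - fst z / R powr \<beta> \<le> 1" using True by simp_all
  then have "(1 - fst z / R powr \<beta>) ^ time_exponent p * g z powr p \<le> g z powr p"
    by (intro mult_left_le_one_le power_le_one zero_le_power) auto
  then show ?thesis using True by (simp add: weighted_powr u_power_def)
qed (auto simp: weighted_powr u_power_def indicator_def)

text \<open>On a fixed bounded box the weight tends to 1 uniformly as R grows, so the energies
  control \<open>u_power\<close> there without integrability being known in advance.\<close>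

definition u_power_box :: "real \<Rightarrow> real \<times> (real^'n) \<Rightarrow> real" where
  "u_power_box M z = indicator ({0<..<M} \<times> cball 0 M) z * u_power z"

lemma borel_measurable_u_power_box [measurable]: "u_power_box M \<in> borel_measurable borel"
proof -
  have [measurable]: "{0<..<M} \<times> cball (0::real^'n) M \<in> sets borel" by (simp add: borel_prod[symmetric])
  show ?thesis unfolding u_power_box_def[abs_def] by measurable
qed

lemma u_power_box_nonneg: "0 \<le> u_power_box M z"
  unfolding u_power_box_def by (simp add: u_power_nonneg)

text \<open>Before time M the weight is at least (1 - M/R^\<beta>)^l, which eventually exceeds 1/2;
  this is the source of the factor 2.\<close>

lemma u_power_box_le:
  "\<forall>\<^sub>F R in at_top. \<forall>z. u_power_box M z \<le> 2 * (indicator (cball 0 (R / 2)) (snd z) * weighted R z powr p)"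
proof -
  have top: "filterlim (\<lambda>R::real. R powr \<beta>) at_top at_top" using \<beta>(1) by real_asymp
  have "((\<lambda>R. (1 - M / R powr \<beta>) ^ time_exponent p) \<longlongrightarrow> (1 - 0) ^ time_exponent p) at_top"
    by (intro tendsto_intros tendsto_divide_0[OF tendsto_const] filterlim_at_top_imp_at_infinity top)
  then have "\<forall>\<^sub>F R in at_top. 1 / 2 < (1 - M / R powr \<beta>) ^ time_exponent p"
    by (rule order_tendstoD) simp
  moreover have "\<forall>\<^sub>F R in at_top. M < R powr \<beta>"
    using top by (simp add: filterlim_at_top_dense)
  moreover have "\<forall>\<^sub>F R in at_top. max 1 (2 * M) \<le> R" by (rule eventually_ge_at_top)
  ultimately show ?thesis
  proof eventually_elim
    case (elim R)
    show ?case
    proof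
      fix z :: "real \<times> (real^'n)"
      show "u_power_box M z \<le> 2 * (indicator (cball 0 (R / 2)) (snd z) * weighted R z powr p)"
      proof (cases "z \<in> {0<..<M} \<times> cball 0 M")
        case True
        then have z: "0 < fst z" "fst z < M" "norm (snd z) \<le> M" by (auto simp: mem_Times_iff)
        have "(1 - M / R powr \<beta>) ^ time_exponent p \<le> (1 - fst z / R powr \<beta>) ^ time_exponent p"
          using elim z by (intro power_mono diff_mono divide_right_mono) auto
        then have "1 * g z powr p \<le> 2 * (1 - fst z / R powr \<beta>) ^ time_exponent p * g z powr p"
          using elim by (intro mult_right_mono) auto
        then show ?thesis using z elim True by (simp add: u_power_box_def u_power_def weighted_powr)
      qed (simp add: u_power_box_def)
    qed
  qed
qed

text \<open>For each box a single sufficiently large good radius is enough, so a frequent energy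
  bound suffices.\<close>

lemma u_power_box_integral_le:
  assumes "\<exists>\<^sub>F R in at_top. energy R (cball 0 (R / 2)) \<le> B"
  shows "integrable lborel (u_power_box M)" "integral\<^sup>L lborel (u_power_box M) \<le> 2 * B"
proof -
  obtain C where int: "\<And>R. R0 < R \<Longrightarrow> integrable lborel (\<lambda>z. indicator (cball 0 (2 * R)) (snd z) * weighted R z powr p)"
    using energy_inequality by blast
  have "\<forall>\<^sub>F R in at_top. R0 < R \<and> (\<forall>z. u_power_box M z \<le> 2 * (indicator (cball 0 (R / 2)) (snd z) * weighted R z powr p))"
    by (intro eventually_conj eventually_gt_at_top u_power_box_le)
  from frequently_eventually_conj[OF assms this]
  obtain R where R: "R0 < R" "\<And>z. u_power_box M z \<le> 2 * (indicator (cball 0 (R / 2)) (snd z) * weighted R z powr p)"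
    and B: "energy R (cball 0 (R / 2)) \<le> B"
    by (blast dest: frequently_ex)
  have sub: "cball (0::real^'n) (R / 2) \<subseteq> cball 0 (2 * R)" using R R0 by (intro subset_cball) auto
  have i: "integrable lborel (\<lambda>z. indicator (cball 0 (R / 2)) (snd z) * weighted R z powr p)"
    by (rule energy_subset_integrable[OF int[OF R(1)] sub]) simp
  show bi: "integrable lborel (u_power_box M)"
    by (rule Bochner_Integration.integrable_bound[of _ "\<lambda>z. 2 * (indicator (cball 0 (R / 2)) (snd z) * weighted R z powr p)"])
      (use i R u_power_box_nonneg in \<open>auto intro!: AE_I2\<close>)
  have "integral\<^sup>L lborel (u_power_box M) \<le> (LINT z|lborel. 2 * (indicator (cball 0 (R / 2)) (snd z) * weighted R z powr p))"
    using bi i R by (intro integral_mono) auto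
  also have "\<dots> = 2 * energy R (cball 0 (R / 2))" by (simp add: energy_def)
  finally show "integral\<^sup>L lborel (u_power_box M) \<le> 2 * B" using B by simp
qed

lemma u_power_box_limit: "(\<lambda>m. u_power_box (real m) z) \<longlonglongrightarrow> u_power z"
proof (cases "0 < fst z")
  case True
  have "\<forall>\<^sub>F m in sequentially. max (fst z) (norm (snd z)) < real m"
    using filterlim_real_sequentially by (simp add: filterlim_at_top_dense eventually_conj_iff)
  then have "\<forall>\<^sub>F m in sequentially. u_power_box (real m) z = u_power z"
    by eventually_elim (use True in \<open>auto simp: u_power_box_def mem_Times_iff\<close>)
  then show ?thesis by (rule tendsto_eventually)
qed (auto simp: u_power_box_def u_power_def indicator_def)

text \<open>Fatou's lemma along the boxes of integer size, whose integrals have a common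
  bound.\<close>

lemma u_power_integrable:
  assumes "\<exists>\<^sub>F R in at_top. energy R (cball 0 (R / 2)) \<le> B"
  shows "integrable lborel u_power"
proof -
  have "(\<integral>\<^sup>+z. ennreal (u_power z) \<partial>lborel) = (\<integral>\<^sup>+z. liminf (\<lambda>m. ennreal (u_power_box (real m) z)) \<partial>lborel)"
    by (intro nn_integral_cong lim_imp_Liminf[symmetric] tendsto_ennrealI u_power_box_limit) simp
  also have "\<dots> \<le> liminf (\<lambda>m. \<integral>\<^sup>+z. ennreal (u_power_box (real m) z) \<partial>lborel)"
    by (rule nn_integral_liminf) measurable
  also have "\<dots> \<le> liminf (\<lambda>m. ennreal (2 * B))"
  proof (intro Liminf_mono always_eventually allI)
    fix m
    have "(\<integral>\<^sup>+z. ennreal (u_power_box (real m) z) \<partial>lborel) = ennreal (integral\<^sup>L lborel (u_power_box (real m)))"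
      using u_power_box_integral_le(1)[OF assms] u_power_box_nonneg by (intro nn_integral_eq_integral) auto
    also have "\<dots> \<le> ennreal (2 * B)" using u_power_box_integral_le(2)[OF assms] by (intro ennreal_leI)
    finally show "(\<integral>\<^sup>+z. ennreal (u_power_box (real m) z) \<partial>lborel) \<le> ennreal (2 * B)" .
  qed
  also have "\<dots> = ennreal (2 * B)" by (simp add: Liminf_const)
  also have "\<dots> < \<infinity>" by simp
  finally show ?thesis using u_power_nonneg by (intro integrableI_nonneg) auto
qed

text \<open>The removed ball has radius \<kappa> R tending to infinity, so the outer energy is below
  a tail of the integrable \<open>u_power\<close>.\<close>

lemma outer_energy_tendsto_0:
  assumes "integrable lborel u_power" "0 < \<kappa>"
  shows "((\<lambda>R. energy R (cball 0 (2 * R) - cball 0 (\<kappa> * R))) \<longlongrightarrow> 0) at_top"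
proof -
  obtain C where int: "\<And>R. R0 < R \<Longrightarrow> integrable lborel (\<lambda>z. indicator (cball 0 (2 * R)) (snd z) * weighted R z powr p)"
    using energy_inequality by blast
  define s where "s R z = indicator (- cball 0 (\<kappa> * R)) (snd z) * u_power z" for R z
  have s_meas [measurable]: "s R \<in> borel_measurable borel" for R
    unfolding s_def[abs_def] by measurable
  have "((\<lambda>R. integral\<^sup>L lborel (s R)) \<longlongrightarrow> (LINT z::real \<times> (real^'n)|lborel. 0)) at_top"
  proof (rule integral_dominated_convergence_at_top[where w = u_power])
    show "AE z in lborel. ((\<lambda>R. s R z) \<longlongrightarrow> 0) at_top"
    proof (intro AE_I2)
      fix z :: "real \<times> (real^'n)"
      have "\<forall>\<^sub>F R in at_top. norm (snd z) / \<kappa> \<le> R" by (rule eventually_ge_at_top)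
      then have "\<forall>\<^sub>F R in at_top. s R z = 0"
        by eventually_elim (use assms(2) in \<open>auto simp: s_def field_simps\<close>)
      then show "((\<lambda>R. s R z) \<longlongrightarrow> 0) at_top" by (rule tendsto_eventually)
    qed
    show "\<forall>\<^sub>F R in at_top. AE z in lborel. norm (s R z) \<le> u_power z"
      using u_power_nonneg by (intro always_eventually allI AE_I2) (auto simp: s_def indicator_def)
  qed (use assms in auto)
  then have lim: "((\<lambda>R. integral\<^sup>L lborel (s R)) \<longlongrightarrow> 0) at_top" by simp
  show ?thesis
  proof (rule tendsto_sandwich[OF _ _ tendsto_const lim])
    show "\<forall>\<^sub>F R in at_top. energy R (cball 0 (2 * R) - cball 0 (\<kappa> * R)) \<le> integral\<^sup>L lborel (s R)"
      using eventually_gt_at_top[of R0]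
    proof eventually_elim
      case (elim R)
      have "integrable lborel (s R)"
        by (rule Bochner_Integration.integrable_bound[OF assms(1)]) (auto simp: s_def indicator_def)
      moreover have "integrable lborel (\<lambda>z. indicator (cball 0 (2 * R) - cball 0 (\<kappa> * R)) (snd z) * weighted R z powr p)"
        by (rule energy_subset_integrable[OF int[OF elim]]) auto
      ultimately show ?case
        unfolding energy_def using weighted_powr_le_u_power u_power_nonneg
        by (intro integral_mono) (auto simp: s_def indicator_def)
    qed
  qed (simp add: energy_nonneg)
qed

text \<open>The estimate is used twice, first for a crude uniform bound and then, once integrability
  makes the outer energy vanish in the limit, for an arbitrarily small one. The tolerance fixes
  \<kappa> and e, and only then R grows.\<close>

lemma trivial_of_critical_growth:
  assumes c: "0 < c" and freq: "\<exists>\<^sub>F R in at_top. c < K R * R powr ((real CARD('n) + \<beta>) / p)"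
    and u0: "u0 locally_integrable_on UNIV"
    and lower: "\<And>\<epsilon>. 0 < \<epsilon> \<Longrightarrow> \<forall>\<^sub>F R in at_top. - \<epsilon> * R ^ CARD('n) * K R \<le> (LINT x : cball 0 R | lebesgue. u0 x)"
  shows "AE z in lborel. 0 < fst z \<longrightarrow> g z = 0"
proof -
  let ?n = "CARD('n)"
  obtain C where C: "0 < C" "\<And>\<epsilon> \<kappa> e. \<lbrakk>0 < \<epsilon>; 0 < \<kappa>; 0 < e; \<kappa> \<le> 2\<rbrakk> \<Longrightarrow> \<exists>\<^sub>F R in at_top.
    energy R (cball 0 (R / 2)) \<le> C * (\<epsilon> + \<kappa> ^ ?n + e * energy R (cball 0 (2 * R) - cball 0 (\<kappa> * R)) + e powr (- 1 / (p - 1)))"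
    using energy_estimate[OF assms] by blast
  \<comment> \<open>With \<kappa> = 2 the outer region is empty, so the right-hand side no longer
    involves the solution.\<close>
  have "energy R (cball 0 (2 * R) - cball 0 (2 * R)) = 0" for R by (simp add: energy_def)
  then have "\<exists>\<^sub>F R in at_top. energy R (cball 0 (R / 2)) \<le> C * (1 + 2 ^ ?n + 1)"
    using C(2)[of 1 2 1] by simp
  then have di: "integrable lborel u_power" by (rule u_power_integrable)
  have box0: "integral\<^sup>L lborel (u_power_box M) \<le> 0" for M
  proof (rule field_le_epsilon)
    fix \<delta>' :: real assume "0 < \<delta>'"
    \<comment> \<open>Four terms of size \<delta>, the constant C and the factor 2 of the box bound
      make 8 C \<delta>.\<close>
    define \<delta> where "\<delta> = \<delta>' / (8 * C)"
    have \<delta>: "0 < \<delta>" using \<open>0 < \<delta>'\<close> C(1) by (simp add: \<delta>_def)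
    define \<kappa> where "\<kappa> = min \<delta> 1"
    \<comment> \<open>Solves e^(-1/(p-1)) = \<delta>. This e may be huge, but it is fixed while the
      outer energy tends to 0.\<close>
    define e where "e = \<delta> powr (- (p - 1))"
    have \<kappa>: "0 < \<kappa>" "\<kappa> \<le> 1" "\<kappa> \<le> \<delta>" using \<delta> by (auto simp: \<kappa>_def)
    have e: "0 < e" using \<delta> by (simp add: e_def)
    have "\<kappa> ^ ?n \<le> \<kappa> ^ 1" using \<kappa> by (intro power_decreasing) (auto simp: Suc_le_eq)
    then have \<kappa>n: "\<kappa> ^ ?n \<le> \<delta>" using \<kappa> by simp
    have eq: "e powr (- 1 / (p - 1)) = \<delta>" proof -
      have "- (p - 1) * (- 1 / (p - 1)) = 1" using p by (simp add: field_simps)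
      then show ?thesis using \<delta> unfolding e_def powr_powr by simp
    qed
    have "((\<lambda>R. e * energy R (cball 0 (2 * R) - cball 0 (\<kappa> * R))) \<longlongrightarrow> e * 0) at_top"
      by (intro tendsto_intros outer_energy_tendsto_0 di \<kappa>)
    then have "\<forall>\<^sub>F R in at_top. e * energy R (cball 0 (2 * R) - cball 0 (\<kappa> * R)) < \<delta>"
      by (rule order_tendstoD) (use \<delta> in simp)
    then have "\<forall>\<^sub>F R in at_top. energy R (cball 0 (R / 2)) \<le>
        C * (\<delta> + \<kappa> ^ ?n + e * energy R (cball 0 (2 * R) - cball 0 (\<kappa> * R)) + e powr (- 1 / (p - 1)))
        \<longrightarrow> energy R (cball 0 (R / 2)) \<le> C * (4 * \<delta>)"
    proof eventually_elim
      case (elim R)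
      then have "C * (\<delta> + \<kappa> ^ ?n + e * energy R (cball 0 (2 * R) - cball 0 (\<kappa> * R)) + e powr (- 1 / (p - 1))) \<le> C * (4 * \<delta>)"
        unfolding eq using \<kappa>n C(1) by (intro mult_left_mono) auto
      then show ?case by linarith
    qed
    moreover have "\<exists>\<^sub>F R in at_top. energy R (cball 0 (R / 2)) \<le>
        C * (\<delta> + \<kappa> ^ ?n + e * energy R (cball 0 (2 * R) - cball 0 (\<kappa> * R)) + e powr (- 1 / (p - 1)))"
      using \<kappa> \<delta> e by (intro C) auto
    ultimately have "\<exists>\<^sub>F R in at_top. energy R (cball 0 (R / 2)) \<le> C * (4 * \<delta>)"
      by (rule frequently_mp)
    then have "integral\<^sup>L lborel (u_power_box M) \<le> 2 * (C * (4 * \<delta>))" by (rule u_power_box_integral_le)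
    then show "integral\<^sup>L lborel (u_power_box M) \<le> 0 + \<delta>'" using C(1) by (simp add: \<delta>_def)
  qed
  have "AE z in lborel. u_power_box (real m) z = 0" for m
  proof -
    have i: "integrable lborel (u_power_box (real m))"
      by (rule Bochner_Integration.integrable_bound[OF di])
        (use u_power_nonneg in \<open>auto intro!: AE_I2 simp: u_power_box_def indicator_def\<close>)
    moreover have "integral\<^sup>L lborel (u_power_box (real m)) = 0"
      by (rule antisym[OF box0]) (simp add: integral_nonneg_AE u_power_box_nonneg)
    ultimately show ?thesis using integral_nonneg_eq_0_iff_AE[OF i] u_power_box_nonneg by auto
  qed
  then have "AE z in lborel. \<forall>m. u_power_box (real m) z = 0" by (simp add: AE_all_countable)
  then show ?thesis
  proof eventually_elim
    case (elim z)
    then have "u_power z = 0" using LIMSEQ_unique[OF u_power_box_limit[of z]] by simp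
    then show ?case by (auto simp: u_power_def)
  qed
qed

text \<open>For a vanishing solution the linear side is 0 and the energies are nonnegative, so the
  data tested with the cutoff are nonpositive; the cutoff tends to 1.\<close>

lemma no_positive_mass:
  assumes g0: "AE z in lborel. 0 < fst z \<longrightarrow> g z = 0" and u0: "integrable lebesgue u0"
  shows "(LINT x|lebesgue. u0 x) \<le> 0"
proof -
  obtain C where E: "\<And>R. R0 < R \<Longrightarrow> \<omega> / 2 * R ^ CARD('n) * (K (3 * R) * energy R (cball 0 (2 * R))) +
    \<omega> / 2 * (R / 2) ^ CARD('n) * (K R * energy R (cball 0 (R / 2))) +
    (LINT x|lebesgue. u0 x * cutoff R x) \<le> C * R powr (- \<beta>) * mass R (cball 0 (2 * R))"
    using energy_inequality by blast
  have m0: "mass R A = 0" for R A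
  proof -
    have "AE z in lborel. indicator A (snd z) * weighted R z = 0"
      using g0 by eventually_elim (auto simp: weighted_def damped_def indicator_def)
    then have "mass R A = (LINT z::real \<times> (real^'n)|lborel. 0)" unfolding mass_def
      by (intro integral_eq_zero_AE[THEN trans]) simp_all
    then show ?thesis by simp
  qed
  have le: "(LINT x|lebesgue. u0 x * cutoff R x) \<le> 0" if R: "R0 < R" for R
  proof -
    have "0 \<le> \<omega> / 2 * R ^ CARD('n) * (K (3 * R) * energy R (cball 0 (2 * R)))"
      "0 \<le> \<omega> / 2 * (R / 2) ^ CARD('n) * (K R * energy R (cball 0 (R / 2)))"
      using R R0 \<omega>_pos by (auto intro!: mult_nonneg_nonneg energy_nonneg less_imp_le[OF K_pos])
    then show ?thesis using E[OF R] unfolding m0 by linarith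
  qed
  have "((\<lambda>R. LINT x|lebesgue. u0 x * cutoff R x) \<longlongrightarrow> (LINT x|lebesgue. u0 x)) at_top"
  proof (rule integral_dominated_convergence_at_top[where w = "\<lambda>x. \<bar>u0 x\<bar>"])
    have "cutoff R \<in> borel_measurable (lebesgue :: (real^'n) measure)" for R
      by (rule measurable_completion) measurable
    then show "(\<lambda>x. u0 x * cutoff R x) \<in> borel_measurable lebesgue" for R
      using borel_measurable_integrable[OF u0] by (rule borel_measurable_times[rotated])
    show "AE x in lebesgue. ((\<lambda>R. u0 x * cutoff R x) \<longlongrightarrow> u0 x) at_top"
    proof (intro AE_I2)
      fix x :: "real^'n"
      have "\<forall>\<^sub>F R in at_top. max 1 (norm x) \<le> R" by (rule eventually_ge_at_top)
      then have "\<forall>\<^sub>F R in at_top. u0 x * cutoff R x = u0 x"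
        by eventually_elim (simp add: cutoff_eq_1)
      then show "((\<lambda>R. u0 x * cutoff R x) \<longlongrightarrow> u0 x) at_top" by (rule tendsto_eventually)
    qed
    show "\<forall>\<^sub>F R in at_top. AE x in lebesgue. norm (u0 x * cutoff R x) \<le> \<bar>u0 x\<bar>"
      by (intro always_eventually allI AE_I2) (simp add: abs_mult mult_left_le cutoff_nonneg cutoff_le_1)
  qed (use u0 borel_measurable_integrable[OF u0] in auto)
  then show ?thesis
    using le by (intro tendsto_upperbound[where F = at_top]) (auto intro: eventually_mono[OF eventually_gt_at_top[of R0]])
qed

section \<open>Slowly decaying initial data\<close>

text \<open>Taking \<theta> proportional to \<open>K (3 * R)\<close> itself absorbs the whole energy
  without any growth assumption. What remains bounds the data term, of order at least R^(n -
  \<gamma>), by a multiple of R^n \<theta>^(-1/(p-1)), which is an upper bound for the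
  kernel.\<close>

lemma kernel_upper_of_slow_decay:
  assumes \<epsilon>: "0 < \<epsilon>" and \<gamma>: "0 < \<gamma>"
    and u0: "AE x in lebesgue. \<epsilon> * (1 + (norm x)\<^sup>2) powr (- \<gamma> / 2) \<le> u0 x"
  shows "\<exists>c>0. \<forall>\<^sub>F R in at_top. c \<le> inverse (K R) * R powr (\<gamma> * (p - 1) - real CARD('n) - \<beta>)"
proof -
  let ?n = "CARD('n)"
  let ?q = "- 1 / (p - 1)"
  obtain C where C: "C > 0" "\<And>R. R0 < R \<Longrightarrow> integrable lborel (\<lambda>z. indicator (cball 0 (2 * R)) (snd z) * weighted R z powr p)"
    "\<And>R. R0 < R \<Longrightarrow> integrable lebesgue (\<lambda>x. u0 x * cutoff R x)"
    "\<And>R. R0 < R \<Longrightarrow> \<omega> / 2 * R ^ ?n * (K (3 * R) * energy R (cball 0 (2 * R))) +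
    \<omega> / 2 * (R / 2) ^ ?n * (K R * energy R (cball 0 (R / 2))) +
    (LINT x|lebesgue. u0 x * cutoff R x) \<le> C * R powr (- \<beta>) * mass R (cball 0 (2 * R))"
    using energy_inequality by blast
  \<comment> \<open>\<open>a\<close> makes the Young energy term equal to the first term of the
    energy inequality; \<open>b\<close> gathers the constants left after both sides are divided by
    \<omega> R^n.\<close>
  define a where "a = \<omega> / (2 * C)"
  have a: "0 < a" "C * a = \<omega> / 2" using C(1) \<omega>_pos by (simp_all add: a_def)
  define b where "b = \<epsilon> * 2 powr (- \<gamma> / 2) / (C * 2 ^ ?n)"
  have b: "0 < b" using \<epsilon> C(1) by (simp add: b_def)
  have key: "a * b powr (p - 1) \<le> inverse (K (3 * R)) * R powr (\<gamma> * (p - 1) - real ?n - \<beta>)" if R: "R0 < R" for R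
  proof -
    have R1: "1 < R" using R R0 by linarith
    have K3: "0 < K (3 * R)" "0 < K R" using R1 by (auto intro: K_pos)
    define \<theta> where "\<theta> = a * (R powr (real ?n + \<beta>) * K (3 * R))"
    have \<theta>: "0 < \<theta>" using a K3 R1 by (simp add: \<theta>_def)
    define X where "X = energy R (cball 0 (2 * R))"
    have "C * R powr (- \<beta>) * mass R (cball 0 (2 * R)) \<le> C * R powr (- \<beta>) * (\<theta> * X + \<theta> powr ?q * R powr \<beta> * (\<omega> * (2 * R) ^ ?n))"
      unfolding X_def using \<theta> R1 C(1) C(2)[OF R] by (intro mult_left_mono mass_le) auto
    also have "\<dots> = C * a * (R powr (- \<beta>) * R powr (real ?n + \<beta>)) * (K (3 * R) * X) + C * (R powr (- \<beta>) * R powr \<beta>) * \<theta> powr ?q * (\<omega> * (2 * R) ^ ?n)"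
      by (simp add: \<theta>_def algebra_simps)
    also have "\<dots> = \<omega> / 2 * R ^ ?n * (K (3 * R) * X) + C * \<theta> powr ?q * (\<omega> * (2 * R) ^ ?n)"
      unfolding a(2) powr_add[symmetric] using R1 by (simp add: powr_realpow)
    finally have mass: "C * R powr (- \<beta>) * mass R (cball 0 (2 * R)) \<le> \<omega> / 2 * R ^ ?n * (K (3 * R) * X) + C * \<theta> powr ?q * (\<omega> * (2 * R) ^ ?n)" .
    have up: "(LINT x|lebesgue. u0 x * cutoff R x) \<le> C * \<theta> powr ?q * (\<omega> * (2 * R) ^ ?n)"
    proof -
      have "0 \<le> \<omega> / 2 * (R / 2) ^ ?n * (K R * energy R (cball 0 (R / 2)))"
        using R1 \<omega>_pos K3 by (auto intro!: mult_nonneg_nonneg energy_nonneg)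
      then show ?thesis using C(4)[OF R] mass unfolding X_def by linarith
    qed
    have ball: "cball (0::real^'n) R \<in> sets lebesgue" "emeasure lebesgue (cball (0::real^'n) R) = ennreal (\<omega> * R ^ ?n)"
      using R1 by (simp_all add: emeasure_cball \<omega>_eq)
    have ball_int: "integrable lebesgue (\<lambda>x. indicator (cball (0::real^'n) R) x :: real)"
      using ball by simp
    \<comment> \<open>Only the ball where the cutoff is 1 is kept: there 1 + \<bar>x\<bar>^2 \<le> 2
      R^2 since R > 1, and elsewhere the data are nonnegative.\<close>
    have "(LINT x|lebesgue. \<epsilon> * (2 * R\<^sup>2) powr (- \<gamma> / 2) * indicator (cball (0::real^'n) R) x) \<le> (LINT x|lebesgue. u0 x * cutoff R x)"
    proof (rule integral_mono_AE)
      show "AE x in lebesgue. \<epsilon> * (2 * R\<^sup>2) powr (- \<gamma> / 2) * indicator (cball (0::real^'n) R) x \<le> u0 x * cutoff R x"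
        using u0
      proof eventually_elim
        case (elim x)
        then have u0x: "0 \<le> u0 x" using \<epsilon> by (meson less_imp_le mult_nonneg_nonneg order_trans powr_ge_zero)
        show ?case
        proof (cases "norm x \<le> R")
          case True
          have "(norm x)\<^sup>2 \<le> R\<^sup>2" using True by (intro power_mono) auto
          moreover have "1 \<le> R\<^sup>2" using R1 by (simp add: one_le_power)
          ultimately have "1 + (norm x)\<^sup>2 \<le> 2 * R\<^sup>2" by linarith
          then have "(2 * R\<^sup>2) powr (- \<gamma> / 2) \<le> (1 + (norm x)\<^sup>2) powr (- \<gamma> / 2)"
            using \<gamma> by (intro powr_mono2') (auto simp: add_pos_nonneg)
          then have "\<epsilon> * (2 * R\<^sup>2) powr (- \<gamma> / 2) \<le> u0 x"
            using elim \<epsilon> by (meson less_imp_le mult_left_mono order_trans)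
          then show ?thesis using True R1 by (simp add: cutoff_eq_1)
        next
          case False
          then show ?thesis using u0x by (simp add: cutoff_nonneg)
        qed
      qed
    qed (use ball_int C(3)[OF R] in auto)
    also have "(LINT x|lebesgue. \<epsilon> * (2 * R\<^sup>2) powr (- \<gamma> / 2) * indicator (cball (0::real^'n) R) x) = \<epsilon> * (2 * R\<^sup>2) powr (- \<gamma> / 2) * (\<omega> * R ^ ?n)"
      using ball R1 \<omega>_pos by (simp add: measure_def)
    also have "(2 * R\<^sup>2) powr (- \<gamma> / 2) = 2 powr (- \<gamma> / 2) * R powr (- \<gamma>)"
    proof -
      have "(R\<^sup>2) powr (- \<gamma> / 2) = (R powr 2) powr (- \<gamma> / 2)" using R1 by simp
      also have "\<dots> = R powr (- \<gamma>)" by (simp add: powr_powr)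
      finally show ?thesis by (simp add: powr_mult)
    qed
    finally have "\<epsilon> * (2 powr (- \<gamma> / 2) * R powr (- \<gamma>)) * (\<omega> * R ^ ?n) \<le> C * \<theta> powr ?q * (\<omega> * (2 * R) ^ ?n)"
      using up by linarith
    also have "\<dots> = C * \<theta> powr ?q * 2 ^ ?n * (\<omega> * R ^ ?n)" by (simp add: power_mult_distrib)
    finally have "\<epsilon> * (2 powr (- \<gamma> / 2) * R powr (- \<gamma>)) \<le> C * \<theta> powr ?q * 2 ^ ?n"
      using \<omega>_pos R1 by (subst (asm) mult_le_cancel_right_pos) auto
    then have "b * R powr (- \<gamma>) \<le> \<theta> powr ?q"
      using C(1) by (simp add: b_def field_simps)
    then have "(b * R powr (- \<gamma>)) powr (p - 1) \<le> (\<theta> powr ?q) powr (p - 1)"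
      using b p by (intro powr_mono2) auto
    also have "\<dots> = inverse \<theta>"
      unfolding powr_powr using p \<theta> by (simp add: powr_minus)
    also have "(b * R powr (- \<gamma>)) powr (p - 1) = b powr (p - 1) * R powr (- (\<gamma> * (p - 1)))"
      using b by (simp add: powr_mult powr_powr)
    finally have "b powr (p - 1) * R powr (- (\<gamma> * (p - 1))) * \<theta> \<le> 1"
      using \<theta> by (simp add: field_simps)
    then have "(a * b powr (p - 1)) * (R powr (- (\<gamma> * (p - 1))) * R powr (real ?n + \<beta>)) * K (3 * R) \<le> 1"
      by (simp add: \<theta>_def algebra_simps)
    moreover have "R powr (- (\<gamma> * (p - 1))) * R powr (real ?n + \<beta>) = inverse (R powr (\<gamma> * (p - 1) - real ?n - \<beta>))"
      unfolding powr_add[symmetric] powr_minus[symmetric] by (simp add: algebra_simps)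
    ultimately have "(a * b powr (p - 1)) * inverse (R powr (\<gamma> * (p - 1) - real ?n - \<beta>)) * K (3 * R) \<le> 1" by simp
    then show ?thesis using K3 R1 by (simp add: field_simps)
  qed
  \<comment> \<open>\<open>key\<close> is read at R/3 to turn \<open>K (3 * R)\<close> into
    \<open>K R\<close>; the power of 3 compensates the rescaled radius.\<close>
  define c where "c = 3 powr (\<gamma> * (p - 1) - real ?n - \<beta>) * (a * b powr (p - 1))"
  have "0 < c" using a b by (simp add: c_def)
  moreover have "\<forall>\<^sub>F R in at_top. c \<le> inverse (K R) * R powr (\<gamma> * (p - 1) - real ?n - \<beta>)"
    using eventually_gt_at_top[of "3 * R0"]
  proof eventually_elim
    case (elim R)
    then have R: "R0 < R / 3" by simp
    have "c \<le> 3 powr (\<gamma> * (p - 1) - real ?n - \<beta>) * (inverse (K R) * (R / 3) powr (\<gamma> * (p - 1) - real ?n - \<beta>))"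
      unfolding c_def using key[OF R] by (intro mult_left_mono) auto
    also have "\<dots> = inverse (K R) * R powr (\<gamma> * (p - 1) - real ?n - \<beta>)"
      using R R0 by (simp add: powr_divide)
    finally show ?case .
  qed
  ultimately show ?thesis by blast
qed

end

section \<open>Deduction of the three nonexistence statements\<close>

lemma global_solution_representative:
  fixes u :: "real \<Rightarrow> real^'n \<Rightarrow> real"
  assumes "global_weak_solution K \<beta> p u0 u" "nonneg_ae u"
  shows "\<exists>g \<in> borel_measurable borel. (\<forall>z. 0 \<le> g z) \<and> (AE z in lborel. 0 < fst z \<longrightarrow> u (fst z) (snd z) = g z)"
proof -
  have "(\<lambda>(t, x). u t x) locally_integrable_on open_cyl \<infinity>"
    using assms(1) by (simp add: weak_solution_def)
  then obtain f where f [measurable]: "f \<in> borel_measurable borel" and uf: "AE z in lborel. 0 < fst z \<longrightarrow> (\<lambda>(t, x). u t x) z = f z"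
    using locally_integrable_ex_borel by blast
  have "AE z in lborel. 0 < fst z \<longrightarrow> 0 \<le> u (fst z) (snd z)"
    using assms(2) unfolding nonneg_ae_def AE_completion_iff by (simp add: open_cyl_infinity case_prod_beta mem_Times_iff)
  \<comment> \<open>Truncating at 0 makes the representative nonnegative at every point, and changes
    nothing almost everywhere.\<close>
  with uf have "AE z in lborel. 0 < fst z \<longrightarrow> u (fst z) (snd z) = max 0 (f z)"
    by eventually_elim (auto simp: case_prod_beta)
  then show ?thesis by (intro bexI[of _ "\<lambda>z. max 0 (f z)"]) auto
qed

lemma Limsup_pos_frequently:
  fixes f :: "real \<Rightarrow> real"
  assumes "0 < Limsup at_top (\<lambda>R. ereal (f R))"
  shows "\<exists>c>0. \<exists>\<^sub>F R in at_top. c < f R"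
proof -
  obtain c where c: "0 < ereal c" "ereal c < Limsup at_top (\<lambda>R. ereal (f R))"
    using ereal_dense2[OF assms] by auto
  have "\<exists>\<^sub>F R in at_top. c < f R"
  proof (rule ccontr)
    assume "\<not> ?thesis"
    then have "\<forall>\<^sub>F R in at_top. ereal (f R) \<le> ereal c" by (simp add: not_frequently not_less)
    then have "Limsup at_top (\<lambda>R. ereal (f R)) \<le> ereal c" by (rule Limsup_bounded)
    then show False using c by simp
  qed
  then show ?thesis using c by auto
qed

theorem theorem1p7:
  fixes K :: "real \<Rightarrow> real" and \<beta> p :: real and u0 :: "real^'n \<Rightarrow> real"
  assumes "0 < \<beta>" and "\<beta> \<le> 2" and "1 < p"
    and "continuous_on {0<..} K"
    and "\<And>r. 0 < r \<Longrightarrow> 0 < K r"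
    and "(\<lambda>x::real^'n. K (norm x)) locally_integrable_on UNIV"
    and "\<exists>R0>1. \<forall>R>R0. (INF r\<in>{0<..<R}. K r) = K R"
  shows
   "(integrable lebesgue u0 \<and>
     (LINT x | lebesgue. u0 x) > 0 \<and>
     Limsup at_top (\<lambda>R. ereal (K R * R powr ((real CARD('n) + \<beta>) / p))) > 0
     \<longrightarrow> \<not> (\<exists>u. global_weak_solution K \<beta> p u0 u \<and> nonneg_ae u)) \<and>
    (u0 locally_integrable_on UNIV \<and>
     Liminf at_top (\<lambda>R. ereal (R powr (- real CARD('n)) * inverse (K R) *
       (LINT x : cball 0 R | lebesgue. u0 x))) \<ge> 0 \<and>
     Limsup at_top (\<lambda>R. ereal (K R * R powr ((real CARD('n) + \<beta>) / p))) > 0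
     \<longrightarrow> \<not> (\<exists>u. global_weak_solution K \<beta> p u0 u \<and> nontrivial u \<and> nonneg_ae u)) \<and>
    (\<forall>\<epsilon>>0. \<forall>\<gamma>>0. u0 locally_integrable_on UNIV \<and>
     (AE x in lebesgue. u0 x \<ge> \<epsilon> * (1 + (norm x)\<^sup>2) powr (- \<gamma> / 2)) \<and>
     Liminf at_top (\<lambda>R. ereal (inverse (K R) *
       R powr (\<gamma> * (p - 1) - real CARD('n) - \<beta>))) = 0
     \<longrightarrow> \<not> (\<exists>u. global_weak_solution K \<beta> p u0 u \<and> nonneg_ae u))"
proof -
  obtain R0 where R0: "1 < R0" "\<And>R. R0 < R \<Longrightarrow> (INF r\<in>{0<..<R}. K r) = K R"
    using assms(7) by blast
  have ex_locale: "\<exists>g. nonneg_solution K \<beta> p R0 (unit_ball_vol (real CARD('n))) u0 u g"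
    if "global_weak_solution K \<beta> p u0 u" "nonneg_ae u" for u
    using global_solution_representative[OF that] assms R0 that unfolding nonneg_solution_def by blast
  have critical: "AE z in lborel. 0 < fst z \<longrightarrow> g z = 0"
    if sol: "nonneg_solution K \<beta> p R0 (unit_ball_vol (real CARD('n))) u0 u g"
      and u0: "u0 locally_integrable_on UNIV"
      and limsup: "Limsup at_top (\<lambda>R. ereal (K R * R powr ((real CARD('n) + \<beta>) / p))) > 0"
      and liminf: "Liminf at_top (\<lambda>R. ereal (R powr (- real CARD('n)) * inverse (K R) * (LINT x : cball 0 R | lebesgue. u0 x))) \<ge> 0"
    for u g
  proof -
    obtain c where c: "0 < c" "\<exists>\<^sub>F R in at_top. c < K R * R powr ((real CARD('n) + \<beta>) / p)"
      using Limsup_pos_frequently[OF limsup] by blast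
    show ?thesis
    proof (rule nonneg_solution.trivial_of_critical_growth[OF sol c u0])
      fix \<epsilon> :: real assume \<epsilon>: "0 < \<epsilon>"
      \<comment> \<open>A nonnegative liminf means that the quotient eventually exceeds each
        negative number; multiplying by R^n K R gives the one-sided bound on ball integrals.\<close>
      have "ereal (- \<epsilon>) < 0" using \<epsilon> by simp
      also note liminf
      finally have "\<forall>\<^sub>F R in at_top. ereal (- \<epsilon>) < ereal (R powr (- real CARD('n)) * inverse (K R) * (LINT x : cball 0 R | lebesgue. u0 x))"
        by (rule less_LiminfD)
      then show "\<forall>\<^sub>F R in at_top. - \<epsilon> * R ^ CARD('n) * K R \<le> (LINT x : cball 0 R | lebesgue. u0 x)"
        using eventually_gt_at_top[of 0]
      proof eventually_elim
        case (elim R)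
        define m where "m = (LINT x : cball 0 R | lebesgue. u0 x)"
        have "0 < R ^ CARD('n) * K R" using elim assms(5) by simp
        moreover have "- \<epsilon> < m / (R ^ CARD('n) * K R)"
          using elim by (simp add: m_def powr_minus powr_realpow field_simps)
        ultimately have "- \<epsilon> * (R ^ CARD('n) * K R) < m"
          by (simp only: pos_less_divide_eq)
        then show ?case by (simp add: m_def mult.assoc)
      qed
    qed
  qed
  have i: "False"
    if u0: "integrable lebesgue u0" and pos: "(LINT x | lebesgue. u0 x) > 0"
      and limsup: "Limsup at_top (\<lambda>R. ereal (K R * R powr ((real CARD('n) + \<beta>) / p))) > 0"
      and u: "global_weak_solution K \<beta> p u0 u" "nonneg_ae u" for u
  proof -
    obtain g where g: "nonneg_solution K \<beta> p R0 (unit_ball_vol (real CARD('n))) u0 u g"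
      using ex_locale[OF u] by blast
    have set_int: "set_integrable lebesgue S u0" if "S \<in> sets lebesgue" for S
      unfolding set_integrable_def by (rule integrable_mult_indicator[OF that u0])
    have loc: "u0 locally_integrable_on UNIV"
      unfolding locally_integrable_on_def by (auto intro!: set_int lmeasurable_compact fmeasurableD)
    \<comment> \<open>Case (i) reduces to the vanishing result behind (ii): the ball integrals tend
      to a positive total mass, so they are eventually positive and the liminf condition holds. The
      vanishing solution then contradicts the positive mass.\<close>
    have lim: "((\<lambda>R. LINT x : cball 0 R | lebesgue. u0 x) \<longlongrightarrow> (LINT x | lebesgue. u0 x)) at_top"
      unfolding set_lebesgue_integral_def
    proof (rule integral_dominated_convergence_at_top[where w = "\<lambda>x. \<bar>u0 x\<bar>"])
      show "(\<lambda>x. indicator (cball 0 R) x *\<^sub>R u0 x) \<in> borel_measurable lebesgue" for R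
        using set_int[of "cball 0 R"] by (auto simp: set_integrable_def dest: borel_measurable_integrable)
      show "AE x in lebesgue. ((\<lambda>R. indicator (cball 0 R) x *\<^sub>R u0 x) \<longlongrightarrow> u0 x) at_top"
      proof (intro AE_I2)
        fix x :: "real^'n"
        have "\<forall>\<^sub>F R in at_top. norm x \<le> R" by (rule eventually_ge_at_top)
        then have "\<forall>\<^sub>F R in at_top. indicator (cball 0 R) x *\<^sub>R u0 x = u0 x" by eventually_elim simp
        then show "((\<lambda>R. indicator (cball 0 R) x *\<^sub>R u0 x) \<longlongrightarrow> u0 x) at_top" by (rule tendsto_eventually)
      qed
      show "\<forall>\<^sub>F R in at_top. AE x in lebesgue. norm (indicator (cball 0 R) x *\<^sub>R u0 x) \<le> \<bar>u0 x\<bar>"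
        by (intro always_eventually allI AE_I2) (simp add: indicator_def)
    qed (use u0 borel_measurable_integrable[OF u0] in auto)
    have liminf: "Liminf at_top (\<lambda>R. ereal (R powr (- real CARD('n)) * inverse (K R) * (LINT x : cball 0 R | lebesgue. u0 x))) \<ge> 0"
    proof (rule Liminf_bounded)
      show "\<forall>\<^sub>F R in at_top. 0 \<le> ereal (R powr (- real CARD('n)) * inverse (K R) * (LINT x : cball 0 R | lebesgue. u0 x))"
        using order_tendstoD(1)[OF lim pos] eventually_gt_at_top[of 0]
        by eventually_elim (auto intro!: mult_nonneg_nonneg less_imp_le[OF assms(5)])
    qed
    show False
      using nonneg_solution.no_positive_mass[OF g critical[OF g loc limsup liminf] u0] pos by simp
  qed
  have ii: "False"
    if "u0 locally_integrable_on UNIV"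
      "Liminf at_top (\<lambda>R. ereal (R powr (- real CARD('n)) * inverse (K R) * (LINT x : cball 0 R | lebesgue. u0 x))) \<ge> 0"
      "Limsup at_top (\<lambda>R. ereal (K R * R powr ((real CARD('n) + \<beta>) / p))) > 0"
      and u: "global_weak_solution K \<beta> p u0 u" "nontrivial u" "nonneg_ae u" for u
  proof -
    obtain g where g: "nonneg_solution K \<beta> p R0 (unit_ball_vol (real CARD('n))) u0 u g"
      using ex_locale[OF u(1,3)] by blast
    have "AE z in lborel. 0 < fst z \<longrightarrow> u (fst z) (snd z) = 0"
      using critical[OF g that(1,3,2)] nonneg_solution.u_eq_g[OF g] by eventually_elim auto
    then have "AE (t, x) in lebesgue. (t, x) \<in> open_cyl \<infinity> \<longrightarrow> u t x = 0"
      unfolding AE_completion_iff by (simp add: open_cyl_infinity case_prod_beta mem_Times_iff)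
    then show False using u(2) by (simp add: nontrivial_def)
  qed
  have iii: "False"
    if e: "0 < \<epsilon>" "0 < \<gamma>" and u0: "AE x in lebesgue. u0 x \<ge> \<epsilon> * (1 + (norm x)\<^sup>2) powr (- \<gamma> / 2)"
      and liminf: "Liminf at_top (\<lambda>R. ereal (inverse (K R) * R powr (\<gamma> * (p - 1) - real CARD('n) - \<beta>))) = 0"
      and u: "global_weak_solution K \<beta> p u0 u" "nonneg_ae u" for \<epsilon> \<gamma> u
  proof -
    obtain g where g: "nonneg_solution K \<beta> p R0 (unit_ball_vol (real CARD('n))) u0 u g"
      using ex_locale[OF u] by blast
    obtain c where c: "0 < c" "\<forall>\<^sub>F R in at_top. c \<le> inverse (K R) * R powr (\<gamma> * (p - 1) - real CARD('n) - \<beta>)"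
      using nonneg_solution.kernel_upper_of_slow_decay[OF g e u0] by blast
    \<comment> \<open>An eventual positive lower bound passes to the liminf, which was assumed to be
      0.\<close>
    have "ereal c \<le> Liminf at_top (\<lambda>R. ereal (inverse (K R) * R powr (\<gamma> * (p - 1) - real CARD('n) - \<beta>)))"
      using c(2) by (intro Liminf_bounded) simp
    then show False using c(1) liminf by simp
  qed
  show ?thesis using i ii iii by blast
qed

end
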